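(* Consider the mean-shift model $y=X\beta^\star+\mu^\star+\varepsilon$ with $X\in\mathbb{R}^{n\times p}$ deterministic with columns of unit Euclidean norm, $|\beta^\star|_0\le k$ and $|\mu^\star|_0\le s$ for positive integers $k,s$, and $\varepsilon\sim\mathcal N(0,\sigma^2I_n)$. Let $\lambda_i=\sigma\sqrt{\log(2n/i)}$, $i=1,\dots,n$, let $\nu=4\sigma\sqrt{\log p}$, let $\rho\ge2(4+\sqrt2)$, assume $\sqrt{\log p}\ge\rho\log2/4$, and let $$(\hat\beta,\hat\mu)\in\arg\min_{\beta\in\mathbb{R}^p,\mu\in\mathbb{R}^n}\Big\{\|y-X\beta-\mu\|_2^2+2\nu\|\beta\|_1+2\rho J_\lambda(\mu)\Big\}.$$ Let $k_1=16k\log p/\log2$ and $s_1=s\log(2en/s)/\log2$, and suppose there are constants $\kappa_1>2\kappa_2>0$ such that for all $(\beta,\mu)\in\mathbb{R}^p\times\mathbb{R}^n$ satisfying $$\|\beta\|_1+\sum_{j=1}^n\frac{\lambda_j}{\lambda_n}|\mu|_{(j)}\le5\big(\sqrt{k_1}\|\beta\|_2+\sqrt{s_1}\|\mu\|_2\big)$$ one has $\|X\beta\|_2^2+\|\mu\|_2^2\ge\kappa_1(\|\beta\|_2^2+\|\mu\|_2^2)$ and $|\langle X\beta,\mu\rangle|\le\kappa_2(\|\beta\|_2^2+\|\mu\|_2^2)$. Let $\kappa=\sqrt{\kappa_1-2\kappa_2}$. Then, with probability at least $1-\frac12(s/2n)^s-1/p$, $$\|\hat\beta-\beta^\star\|_2^2+\|\hat\mu-\mu^\star\|_2^2\le\frac{36}{\kappa^4}\sigma^2k\log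 p+\frac{4\rho^2}{\kappa^4}\sum_{j=1}^s\lambda_j^2\le\frac{4\sigma^2}{\kappa^4}\Big(9k\log p+\rho^2s\log\Big(\frac{2en}{s}\Big)\Big).$$
   Context: For $u\in\mathbb{R}^m$, $|u|_0$ is the number of nonzero entries of $u$, and $|u|_{(1)}\ge\dots\ge|u|_{(m)}$ are the absolute values of its entries sorted in non-increasing order. For a vector $\lambda\in\mathbb{R}^m$ with non-negative non-increasing entries, the sorted-$\ell_1$ norm is $J_\lambda(x)=\sum_{j=1}^m\lambda_j|x|_{(j)}$. *)

theory Defs
  imports "HOL-Probability.Probability"
begin

text \<open>Vectors in R^m are represented as functions nat => real, only the
entries with index < m being relevant. Matrices X in R^(n x p) are
functions nat => nat => real, X i j for i < n, j < p.\<close>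

definition l0 :: "nat \<Rightarrow> (nat \<Rightarrow> real) \<Rightarrow> nat" where
  "l0 m u = card {i. i < m \<and> u i \<noteq> 0}"

definition l1 :: "nat \<Rightarrow> (nat \<Rightarrow> real) \<Rightarrow> real" where
  "l1 m u = (\<Sum>i<m. \<bar>u i\<bar>)"

definition sqnorm :: "nat \<Rightarrow> (nat \<Rightarrow> real) \<Rightarrow> real" where
  "sqnorm m u = (\<Sum>i<m. (u i)\<^sup>2)"

definition l2 :: "nat \<Rightarrow> (nat \<Rightarrow> real) \<Rightarrow> real" where
  "l2 m u = sqrt (sqnorm m u)"

definition inner_n :: "nat \<Rightarrow> (nat \<Rightarrow> real) \<Rightarrow> (nat \<Rightarrow> real) \<Rightarrow> real" where
  "inner_n m u v = (\<Sum>i<m. u i * v i)"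

text \<open>Absolute values of the entries, sorted non-increasingly:
  sorted_abs m u ! (j-1) = |u|_(j) for j = 1..m.\<close>
definition sorted_abs :: "nat \<Rightarrow> (nat \<Rightarrow> real) \<Rightarrow> real list" where
  "sorted_abs m u = rev (sort (map (\<lambda>i. \<bar>u i\<bar>) [0..<m]))"

definition ord_abs :: "nat \<Rightarrow> (nat \<Rightarrow> real) \<Rightarrow> nat \<Rightarrow> real" where
  "ord_abs m u j = sorted_abs m u ! (j - 1)"

definition sorted_l1 :: "nat \<Rightarrow> (nat \<Rightarrow> real) \<Rightarrow> (nat \<Rightarrow> real) \<Rightarrow> real" where
  "sorted_l1 m lam x = (\<Sum>j=1..m. lam j * ord_abs m x j)"

definition matvec :: "nat \<Rightarrow> nat \<Rightarrow> (nat \<Rightarrow> nat \<Rightarrow> real) \<Rightarrow> (nat \<Rightarrow> real) \<Rightarrow> (nat \<Rightarrow> real)" where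
  "matvec n p X b = (\<lambda>i. \<Sum>j<p. X i j * b j)"

definition gauss_vec :: "nat \<Rightarrow> real \<Rightarrow> (nat \<Rightarrow> real) measure" where
  "gauss_vec n \<sigma> = PiM {..<n} (\<lambda>_. density lborel (normal_density 0 \<sigma>))"

end

theory Submission
  imports Defs
begin

text \<open>Write \<open>f j = j log (2n / j)\<close>, \<open>C = 4 + \<surd>2\<close> and \<open>\<Lambda>\<^sup>2 = \<lambda>\<^sub>1\<^sup>2 + \<dots> + \<lambda>\<^sub>s\<^sup>2\<close>. Gaussian concentration for
  Lipschitz functions is not needed: it suffices to control the sums of squares of the noise over
  all index sets with at least \<open>s\<close> elements. The exponential moment of a single squared Gaussian and
  a union bound over the sets of size \<open>j\<close> show that such a sum exceeds \<open>C\<^sup>2 \<sigma>\<^sup>2 f j\<close> for some set with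
  probability at most \<open>exp (- f s) / 4 ^ j\<close>, and these bounds add up to at most \<open>(s / 2n) ^ s / 2\<close>.
  On the complementary event the \<open>s\<close> largest noise entries have Euclidean norm at most \<open>C \<Lambda>\<close>, and
  the \<open>j\<close>-th largest is at most \<open>C \<lambda>\<^sub>j\<close> for \<open>j \<ge> s\<close>; by the rearrangement inequality the inner product
  of the noise with \<open>v\<close> is at most \<open>C (\<Lambda> \<parallel>v\<parallel> + \<Sum>\<^sub>j\<^sub>>\<^sub>s \<lambda>\<^sub>j \<bar>v\<bar>\<^sub>(\<^sub>j\<^sub>))\<close>. Similarly all columns of the design
  have inner product at most \<open>\<nu> / 2\<close> with the noise, up to probability \<open>1 / p\<close>. Convexity of the
  objective then gives a basic inequality that places the estimation error in the cone of the
  restricted eigenvalue condition and, combined with that condition, bounds it.\<close>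

section \<open>Rearrangements and the sorted norm\<close>

text \<open>Rearrangement inequality, by induction on \<open>n\<close>: composing
  \<open>\<pi>\<close> with the transposition of \<open>\<pi> n\<close> and \<open>n\<close> makes
  \<open>n\<close> a fixed point, so that the induction hypothesis applies to the rest. Only two
  summands change, and uncrossing them cannot decrease the sum.\<close>

lemma sum_mult_permute_le:
  fixes a b :: "nat \<Rightarrow> real"
  assumes "\<pi> permutes {..<n}"
    and "\<And>i j. i \<le> j \<Longrightarrow> j < n \<Longrightarrow> a j \<le> a i"
    and "\<And>i j. i \<le> j \<Longrightarrow> j < n \<Longrightarrow> b j \<le> b i"
  shows "(\<Sum>j<n. a j * b (\<pi> j)) \<le> (\<Sum>j<n. a j * b j)"
  using assms
proof (induction n arbitrary: \<pi>)
  case 0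
  then show ?case by simp
next
  case (Suc n)
  define \<tau> where "\<tau> = Transposition.transpose (\<pi> n) n \<circ> \<pi>"
  have \<pi>n: "\<pi> n < Suc n"
    using permutes_in_image[OF Suc.prems(1), of n] by simp
  have \<tau>S: "\<tau> permutes {..<Suc n}"
    unfolding \<tau>_def using \<pi>n by (intro permutes_compose[OF Suc.prems(1)] permutes_swap_id) auto
  have \<tau>n: "\<tau> n = n"
    by (simp add: \<tau>_def)
  have "\<tau> permutes {..<n}"
  proof (rule permutes_superset[OF \<tau>S])
    fix x assume "x \<in> {..<Suc n} - {..<n}"
    then have "x = n" by auto
    then show "\<tau> x = x" using \<tau>n by simp
  qed
  then have IH: "(\<Sum>j<n. a j * b (\<tau> j)) \<le> (\<Sum>j<n. a j * b j)"
    by (rule Suc.IH) (use Suc.prems in auto)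
  have "(\<Sum>j<Suc n. a j * b (\<pi> j)) \<le> (\<Sum>j<Suc n. a j * b (\<tau> j))"
  proof (cases "\<pi> n = n")
    case True
    then show ?thesis by (simp add: \<tau>_def)
  next
    case False
    define m where "m = inv \<pi> n"
    have \<pi>m: "\<pi> m = n"
      unfolding m_def using permutes_inverses(1)[OF Suc.prems(1)] by simp
    have "m < Suc n"
      using permutes_in_image[OF Suc.prems(1), of m] \<pi>m by simp
    with False \<pi>m have m: "m < n" by (cases "m = n") auto
    have inj: "\<pi> x = \<pi> y \<longleftrightarrow> x = y" for x y
      using permutes_inj[OF Suc.prems(1)] by (auto dest: injD)
    have rest: "\<tau> j = \<pi> j" if "j \<noteq> m" "j \<noteq> n" for j
      using that inj[of j m] inj[of j n] \<pi>m by (auto simp: \<tau>_def Transposition.transpose_def)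
    have \<tau>m: "\<tau> m = \<pi> n"
      by (simp add: \<tau>_def \<pi>m)
    have split: "(\<Sum>j<Suc n. g j) = (\<Sum>j\<in>{..<n}-{m}. g j) + g m + g n" for g :: "nat \<Rightarrow> real"
      using m by (simp add: sum.remove[of "{..<n}" m])
    \<comment> \<open>\<open>m\<close> is the position that \<open>\<pi>\<close> sends to
      \<open>n\<close>. Expanding this product compares the pairing before the swap,
      \<open>a m\<close> with \<open>b n\<close>, to the pairing after it, \<open>a m\<close> with
      \<open>b (\<pi> n)\<close>.\<close>
    have "(a m - a n) * (b (\<pi> n) - b n) \<ge> 0"
      using Suc.prems(2)[of m n] Suc.prems(3)[of "\<pi> n" n] m \<pi>n by (intro mult_nonneg_nonneg) auto
    then have "a m * b n + a n * b (\<pi> n) \<le> a m * b (\<pi> n) + a n * b n"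
      by (simp add: algebra_simps)
    moreover have "(\<Sum>j\<in>{..<n}-{m}. a j * b (\<pi> j)) = (\<Sum>j\<in>{..<n}-{m}. a j * b (\<tau> j))"
      by (intro sum.cong) (auto simp: rest)
    ultimately show ?thesis
      unfolding split by (simp add: \<pi>m \<tau>m \<tau>n)
  qed
  also have "\<dots> \<le> (\<Sum>j<Suc n. a j * b j)"
    using IH \<tau>n by simp
  finally show ?case .
qed

section \<open>Order statistics of absolute values\<close>

lemma length_sorted_abs [simp]: "length (sorted_abs n u) = n"
  by (simp add: sorted_abs_def)

text \<open>Sorting preserves the multiset of entries. This trades the list in the definition for a
  permutation, so that sums over order statistics become sums over permuted indices. Permutations
  count positions from 0 and \<open>ord_abs\<close> from 1, hence \<open>Suc j\<close>
  throughout.\<close>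

lemma ord_abs_permutation: "\<exists>\<pi>. \<pi> permutes {..<n} \<and> (\<forall>j<n. ord_abs n u (Suc j) = \<bar>u (\<pi> j)\<bar>)"
proof -
  let ?xs = "map (\<lambda>i. \<bar>u i\<bar>) [0..<n]"
  have "mset (sorted_abs n u) = mset ?xs"
    by (simp add: sorted_abs_def)
  then obtain \<pi> where \<pi>: "\<pi> permutes {..<length ?xs}" "permute_list \<pi> ?xs = sorted_abs n u"
    by (rule mset_eq_permutation)
  have "ord_abs n u (Suc j) = \<bar>u (\<pi> j)\<bar>" if "j < n" for j
  proof -
    have "\<pi> j < n"
      using permutes_in_image[OF \<pi>(1), of j] that by simp
    moreover have "permute_list \<pi> ?xs ! j = ?xs ! \<pi> j"
      by (rule permute_list_nth[OF \<pi>(1)]) (use that in simp)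
    ultimately show ?thesis
      by (simp add: ord_abs_def \<pi>(2)[symmetric])
  qed
  with \<pi>(1) show ?thesis by auto
qed

lemma ord_abs_antimono:
  assumes "i \<le> j" "j < n"
  shows "ord_abs n u (Suc j) \<le> ord_abs n u (Suc i)"
proof -
  have "sorted_wrt (\<ge>) (sorted_abs n u)"
    unfolding sorted_abs_def by (simp add: sorted_wrt_rev)
  then show ?thesis
    using assms sorted_wrt_nth_less[of "(\<ge>)" "sorted_abs n u" i j]
    by (cases "i = j") (auto simp: ord_abs_def)
qed

lemma ord_abs_nonneg: "j < n \<Longrightarrow> 0 \<le> ord_abs n u (Suc j)"
  using ord_abs_permutation[of n u] by auto

lemma sorted_l1_altdef: "sorted_l1 n lam u = (\<Sum>j<n. lam (Suc j) * ord_abs n u (Suc j))"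
  unfolding sorted_l1_def by (simp add: sum.atLeast1_atMost_eq)

text \<open>Relative to the sorting permutation \<open>\<pi>\<close>, any order
  \<open>\<tau>\<close> is the rearrangement \<open>inv \<pi> \<circ> \<tau>\<close> of a decreasing
  sequence. Consequently the sorted norm is a maximum of weighted sums over all orders.\<close>

lemma sum_mult_permute_le_ord_abs:
  assumes \<tau>: "\<tau> permutes {..<n}"
    and a: "\<And>i j. i \<le> j \<Longrightarrow> j < n \<Longrightarrow> a j \<le> a i"
  shows "(\<Sum>j<n. a j * \<bar>u (\<tau> j)\<bar>) \<le> (\<Sum>j<n. a j * ord_abs n u (Suc j))"
proof -
  obtain \<pi> where \<pi>: "\<pi> permutes {..<n}" "\<And>j. j < n \<Longrightarrow> ord_abs n u (Suc j) = \<bar>u (\<pi> j)\<bar>"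
    using ord_abs_permutation[of n u] by blast
  have p: "inv \<pi> \<circ> \<tau> permutes {..<n}"
    by (intro permutes_compose \<tau> permutes_inv \<pi>(1))
  have "(\<Sum>j<n. a j * \<bar>u (\<tau> j)\<bar>) = (\<Sum>j<n. a j * ord_abs n u (Suc ((inv \<pi> \<circ> \<tau>) j)))"
  proof (intro sum.cong refl)
    fix j assume "j \<in> {..<n}"
    then have "(inv \<pi> \<circ> \<tau>) j < n"
      using permutes_in_image[OF p, of j] by simp
    then show "a j * \<bar>u (\<tau> j)\<bar> = a j * ord_abs n u (Suc ((inv \<pi> \<circ> \<tau>) j))"
      using permutes_inverses(1)[OF \<pi>(1)] by (simp add: \<pi>(2))
  qed
  also have "\<dots> \<le> (\<Sum>j<n. a j * ord_abs n u (Suc j))"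
    by (rule sum_mult_permute_le[OF p a]) (auto intro: ord_abs_antimono)
  finally show ?thesis .
qed

lemma sum_lessThan_split:
  fixes f :: "nat \<Rightarrow> 'a :: comm_monoid_add"
  assumes "s \<le> n"
  shows "(\<Sum>j<n. f j) = (\<Sum>j<s. f j) + (\<Sum>j=s..<n. f j)"
  using assms by (metis lessThan_atLeast0 sum.atLeastLessThan_concat zero_le)

lemma sum_ord_abs_power2: "(\<Sum>j<n. (ord_abs n u (Suc j))\<^sup>2) = sqnorm n u"
proof -
  obtain \<pi> where \<pi>: "\<pi> permutes {..<n}" "\<And>j. j < n \<Longrightarrow> ord_abs n u (Suc j) = \<bar>u (\<pi> j)\<bar>"
    using ord_abs_permutation[of n u] by blast
  have "(\<Sum>j<n. (ord_abs n u (Suc j))\<^sup>2) = (\<Sum>j<n. (u (\<pi> j))\<^sup>2)"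
    by (intro sum.cong) (auto simp: \<pi>(2))
  also have "\<dots> = sqnorm n u"
    unfolding sqnorm_def using sum.permute[OF \<pi>(1), of "\<lambda>i. (u i)\<^sup>2"] by (simp add: o_def)
  finally show ?thesis .
qed

lemma sqnorm_nonneg: "0 \<le> sqnorm n u"
  unfolding sqnorm_def by (intro sum_nonneg) auto

lemma l2_power2: "(l2 n u)\<^sup>2 = sqnorm n u"
  unfolding l2_def by (simp add: sqnorm_nonneg)

lemma l2_nonneg: "0 \<le> l2 n u"
  unfolding l2_def by (simp add: sqnorm_nonneg)

lemma cauchy_schwarz_sqrt_sum:
  fixes a b :: "'i \<Rightarrow> real"
  shows "(\<Sum>i\<in>A. a i * b i) \<le> sqrt (\<Sum>i\<in>A. (a i)\<^sup>2) * sqrt (\<Sum>i\<in>A. (b i)\<^sup>2)"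
proof -
  have "(\<Sum>i\<in>A. a i * b i) \<le> (\<Sum>i\<in>A. \<bar>a i\<bar> * \<bar>b i\<bar>)"
    by (intro sum_mono) (metis abs_ge_self abs_mult)
  also have "\<dots> \<le> L2_set a A * L2_set b A"
    by (rule L2_set_mult_ineq)
  finally show ?thesis by (simp add: L2_set_def)
qed

lemma sum_ord_abs_le_l2:
  assumes "s \<le> n"
  shows "(\<Sum>j<s. a j * ord_abs n u (Suc j)) \<le> sqrt (\<Sum>j<s. (a j)\<^sup>2) * l2 n u"
proof -
  have "(\<Sum>j<s. (ord_abs n u (Suc j))\<^sup>2) \<le> (\<Sum>j<n. (ord_abs n u (Suc j))\<^sup>2)"
    using assms by (intro sum_mono2) auto
  then have "sqrt (\<Sum>j<s. (ord_abs n u (Suc j))\<^sup>2) \<le> l2 n u"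
    by (simp add: l2_def sum_ord_abs_power2)
  then show ?thesis
    using cauchy_schwarz_sqrt_sum[of a "\<lambda>j. ord_abs n u (Suc j)" "{..<s}"]
    by (smt (verit) mult_left_mono real_sqrt_ge_zero sum_nonneg zero_le_power2)
qed

text \<open>Along the order that sorts the convex combination, the triangle inequality applies
  entrywise. That same order gives at most the sorted norm for each of \<open>x\<close> and
  \<open>y\<close>.\<close>

lemma sorted_l1_convex:
  assumes lam: "\<And>i j. i \<le> j \<Longrightarrow> j < n \<Longrightarrow> lam (Suc j) \<le> lam (Suc i)"
    and nonneg: "\<And>j. j < n \<Longrightarrow> 0 \<le> lam (Suc j)" and t: "0 \<le> t" "t \<le> 1"
  shows "sorted_l1 n lam (\<lambda>i. (1 - t) * x i + t * y i) \<le> (1 - t) * sorted_l1 n lam x + t * sorted_l1 n lam y"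
proof -
  let ?z = "\<lambda>i. (1 - t) * x i + t * y i"
  obtain \<pi> where \<pi>: "\<pi> permutes {..<n}" "\<And>j. j < n \<Longrightarrow> ord_abs n ?z (Suc j) = \<bar>?z (\<pi> j)\<bar>"
    using ord_abs_permutation[of n ?z] by blast
  have "sorted_l1 n lam ?z = (\<Sum>j<n. lam (Suc j) * \<bar>?z (\<pi> j)\<bar>)"
    by (auto simp: sorted_l1_altdef \<pi>(2) intro!: sum.cong)
  also have "\<dots> \<le> (\<Sum>j<n. lam (Suc j) * ((1 - t) * \<bar>x (\<pi> j)\<bar> + t * \<bar>y (\<pi> j)\<bar>))"
  proof (intro sum_mono mult_left_mono)
    fix j
    show "\<bar>?z (\<pi> j)\<bar> \<le> (1 - t) * \<bar>x (\<pi> j)\<bar> + t * \<bar>y (\<pi> j)\<bar>"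
      using abs_triangle_ineq[of "(1 - t) * x (\<pi> j)" "t * y (\<pi> j)"] t by (simp add: abs_mult)
  qed (use nonneg in auto)
  also have "\<dots> = (1 - t) * (\<Sum>j<n. lam (Suc j) * \<bar>x (\<pi> j)\<bar>) + t * (\<Sum>j<n. lam (Suc j) * \<bar>y (\<pi> j)\<bar>)"
    unfolding sum_distrib_left sum.distrib[symmetric] by (intro sum.cong) (auto simp: algebra_simps)
  also have "\<dots> \<le> (1 - t) * sorted_l1 n lam x + t * sorted_l1 n lam y"
    unfolding sorted_l1_altdef using t
    by (intro add_mono mult_left_mono sum_mult_permute_le_ord_abs[OF \<pi>(1)] lam) auto
  finally show ?thesis .
qed

text \<open>A nonzero entry at position \<open>j\<close> would force nonzero entries at all
  \<open>Suc j\<close> positions up to it, which exceeds \<open>s\<close>.\<close>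

lemma ord_abs_permutation_support:
  assumes \<pi>: "\<pi> permutes {..<n}" "\<And>j. j < n \<Longrightarrow> ord_abs n u (Suc j) = \<bar>u (\<pi> j)\<bar>"
    and "l0 n u \<le> s" "s \<le> j" "j < n"
  shows "u (\<pi> j) = 0"
proof (rule ccontr)
  assume nz: "u (\<pi> j) \<noteq> 0"
  have "\<pi> ` {..j} \<subseteq> {i. i < n \<and> u i \<noteq> 0}"
  proof clarify
    fix i assume "i \<le> j"
    then have i: "i < n" using \<open>j < n\<close> by simp
    then have "\<bar>u (\<pi> j)\<bar> \<le> \<bar>u (\<pi> i)\<bar>"
      using ord_abs_antimono[OF \<open>i \<le> j\<close> \<open>j < n\<close>, of u] \<pi>(2) \<open>j < n\<close> by simp
    moreover have "\<pi> i < n"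
      using permutes_in_image[OF \<pi>(1), of i] i by simp
    ultimately show "\<pi> i < n \<and> u (\<pi> i) \<noteq> 0" using nz by auto
  qed
  then have "card (\<pi> ` {..j}) \<le> l0 n u"
    unfolding l0_def by (intro card_mono) auto
  moreover have "card (\<pi> ` {..j}) = Suc j"
    using permutes_inj[OF \<pi>(1)] by (subst card_image) (auto intro: inj_on_subset)
  ultimately show False using assms by simp
qed

text \<open>The norm of \<open>u + v\<close> is bounded from below along a permutation that first lists a set \<open>A\<close> of
  size \<open>s\<close> carrying \<open>u\<close>. Beyond position \<open>s\<close> it follows the decreasing order of
  \<open>\<bar>v\<bar>\<close>, except that entries lying in \<open>A\<close> are replaced by larger ones not in \<open>A\<close>.\<close>

lemma sorted_l1_diff_le:
  assumes lam: "\<And>i j. i \<le> j \<Longrightarrow> j < n \<Longrightarrow> lam (Suc j) \<le> lam (Suc i)"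
    and nonneg: "\<And>j. j < n \<Longrightarrow> 0 \<le> lam (Suc j)"
    and u: "l0 n u \<le> s" and s: "s \<le> n"
  shows "sorted_l1 n lam u - sorted_l1 n lam (\<lambda>i. u i + v i)
    \<le> sqrt (\<Sum>j<s. (lam (Suc j))\<^sup>2) * l2 n v - (\<Sum>j=s..<n. lam (Suc j) * ord_abs n v (Suc j))"
proof -
  obtain \<pi> where \<pi>: "\<pi> permutes {..<n}" "\<And>j. j < n \<Longrightarrow> ord_abs n u (Suc j) = \<bar>u (\<pi> j)\<bar>"
    using ord_abs_permutation[of n u] by blast
  obtain \<omega> where \<omega>: "\<omega> permutes {..<n}" "\<And>j. j < n \<Longrightarrow> ord_abs n v (Suc j) = \<bar>v (\<omega> j)\<bar>"
    using ord_abs_permutation[of n v] by blast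
  define A where "A = \<pi> ` {..<s}"
  \<comment> \<open>\<open>B\<close> collects the late positions where the order of \<open>v\<close>
    runs into \<open>A\<close>. \<open>D\<close> holds the substitutes: indices of the
    \<open>s\<close> largest entries of \<open>v\<close> outside \<open>A\<close>. Both have the
    same size because \<open>A\<close> and the top \<open>s\<close> indices of \<open>v\<close> each
    have \<open>s\<close> elements.\<close>
  define B where "B = {j \<in> {s..<n}. \<omega> j \<in> A}"
  define D where "D = \<omega> ` {..<s} - A"
  have inj\<pi>: "inj_on \<pi> Z" and inj\<omega>: "inj_on \<omega> Z" for Z
    using permutes_inj[OF \<pi>(1)] permutes_inj[OF \<omega>(1)] by (auto intro: inj_on_subset)
  have [simp]: "\<pi> x = \<pi> y \<longleftrightarrow> x = y" "\<omega> x = \<omega> y \<longleftrightarrow> x = y" for x y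
    using permutes_inj[OF \<pi>(1)] permutes_inj[OF \<omega>(1)] by (auto simp: inj_eq)
  have img\<pi>: "\<pi> ` {..<n} = {..<n}" and img\<omega>: "\<omega> ` {..<n} = {..<n}"
    using permutes_image \<pi>(1) \<omega>(1) by auto
  have An: "A \<subseteq> {..<n}"
    unfolding A_def using img\<pi> s by (metis image_mono lessThan_subset_iff)
  have cA: "card A = s"
    unfolding A_def by (simp add: card_image inj\<pi>)
  have "card B = card (\<omega> ` B)"
    by (simp add: card_image inj\<omega>)
  also have "\<omega> ` B = A - \<omega> ` {..<s}"
  proof (intro equalityI subsetI)
    fix x assume "x \<in> \<omega> ` B"
    then obtain j where j: "j \<in> B" "x = \<omega> j" by auto
    have "x \<notin> \<omega> ` {..<s}"
      using j by (auto simp: B_def)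
    then show "x \<in> A - \<omega> ` {..<s}" using j by (auto simp: B_def)
  next
    fix x assume x: "x \<in> A - \<omega> ` {..<s}"
    then obtain j where "j < n" "x = \<omega> j"
      using An img\<omega> by (metis DiffD1 imageE lessThan_iff subsetD)
    then show "x \<in> \<omega> ` B" using x by (cases "j < s") (auto simp: B_def)
  qed
  also have "card \<dots> = card D"
  proof -
    have "card (A - \<omega> ` {..<s}) = card A - card (A \<inter> \<omega> ` {..<s})"
      using An by (intro card_Diff_subset_Int) (auto intro: finite_subset)
    moreover have "card D = card (\<omega> ` {..<s}) - card (\<omega> ` {..<s} \<inter> A)"
      unfolding D_def by (intro card_Diff_subset_Int) auto
    moreover have "card (\<omega> ` {..<s}) = s"
      by (simp add: card_image inj\<omega>)
    ultimately show ?thesis by (simp add: cA Int_commute)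
  qed
  finally have "card B = card D" .
  then obtain g where g: "bij_betw g B D"
    using finite_same_card_bij[of B D] by (auto simp: B_def D_def)
  define \<tau> where "\<tau> j = (if j < s then \<pi> j else if j \<in> B then g j else \<omega> j)" for j
  have "bij_betw \<tau> ({..<s} \<union> (B \<union> ({s..<n} - B))) (A \<union> (D \<union> \<omega> ` ({s..<n} - B)))"
  proof (intro bij_betw_combine)
    show "bij_betw \<tau> {..<s} A"
      unfolding A_def by (rule bij_betw_imageI) (auto simp: \<tau>_def inj_on_def)
    have "bij_betw g B D \<longleftrightarrow> bij_betw \<tau> B D"
      by (intro bij_betw_cong) (auto simp: \<tau>_def B_def)
    then show "bij_betw \<tau> B D" using g by simp
    show "bij_betw \<tau> ({s..<n} - B) (\<omega> ` ({s..<n} - B))"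
      by (rule bij_betw_imageI) (auto simp: \<tau>_def inj_on_def)
    show "D \<inter> \<omega> ` ({s..<n} - B) = {}"
      by (auto simp: D_def)
    show "A \<inter> (D \<union> \<omega> ` ({s..<n} - B)) = {}"
      by (auto simp: D_def B_def)
  qed
  moreover have "{..<s} \<union> (B \<union> ({s..<n} - B)) = {..<n}"
    using s by (auto simp: B_def)
  moreover have "A \<union> (D \<union> \<omega> ` ({s..<n} - B)) = {..<n}"
  proof (intro equalityI subsetI)
    fix x assume "x \<in> A \<union> (D \<union> \<omega> ` ({s..<n} - B))"
    then show "x \<in> {..<n}"
      using An img\<omega> s by (force simp: D_def)
  next
    fix x assume x: "x \<in> {..<n}"
    then obtain j where "j < n" "x = \<omega> j"
      using img\<omega> by (metis imageE lessThan_iff)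
    then show "x \<in> A \<union> (D \<union> \<omega> ` ({s..<n} - B))"
      by (cases "j < s") (auto simp: D_def B_def)
  qed
  ultimately have bij: "bij_betw \<tau> {..<n} {..<n}" by simp
  \<comment> \<open>The predicate \<open>permutes\<close> demands the identity outside
    \<open>{..<n}\<close>.\<close>
  define \<tau>' where "\<tau>' j = (if j < n then \<tau> j else j)" for j
  have \<tau>': "\<tau>' permutes {..<n}"
  proof (rule bij_imp_permutes)
    show "bij_betw \<tau>' {..<n} {..<n}"
      using bij by (subst bij_betw_cong[of _ \<tau>' \<tau>]) (auto simp: \<tau>'_def)
  qed (auto simp: \<tau>'_def)
  have low: "\<tau>' j = \<pi> j" if "j < s" for j
    using that s by (auto simp: \<tau>'_def \<tau>_def)
  note split = sum_lessThan_split[OF s]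
  have uz: "u x = 0" if x: "x \<notin> A" "x < n" for x
  proof -
    obtain j where "j < n" "x = \<pi> j" using x(2) img\<pi> by (metis imageE lessThan_iff)
    then show ?thesis
      using x(1) ord_abs_permutation_support[OF \<pi> u, of j] by (cases "j < s") (auto simp: A_def)
  qed
  have high: "u (\<tau>' j) = 0 \<and> ord_abs n v (Suc j) \<le> \<bar>v (\<tau>' j)\<bar>" if j: "s \<le> j" "j < n" for j
  proof -
    have lt: "\<tau>' j < n"
      using permutes_in_image[OF \<tau>', of j] j by simp
    show ?thesis
    proof (cases "j \<in> B")
      case True
      then have "\<tau>' j \<in> D"
        using j bij_betwE[OF g] by (auto simp: \<tau>'_def \<tau>_def)
      then obtain i where i: "i < s" "\<tau>' j = \<omega> i" "\<tau>' j \<notin> A" by (auto simp: D_def)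
      have "ord_abs n v (Suc j) \<le> ord_abs n v (Suc i)"
        by (rule ord_abs_antimono) (use i j in auto)
      then show ?thesis using i s lt uz \<omega>(2)[of i] by auto
    next
      case False
      then have "\<tau>' j = \<omega> j" "\<tau>' j \<notin> A" using j by (auto simp: \<tau>'_def \<tau>_def B_def)
      then show ?thesis using lt uz \<omega>(2) j by auto
    qed
  qed
  have "sorted_l1 n lam u - (\<Sum>j<s. lam (Suc j) * \<bar>v (\<tau>' j)\<bar>) + (\<Sum>j=s..<n. lam (Suc j) * ord_abs n v (Suc j))
      \<le> (\<Sum>j<n. lam (Suc j) * \<bar>u (\<tau>' j) + v (\<tau>' j)\<bar>)"
  proof -
    have "sorted_l1 n lam u = (\<Sum>j<s. lam (Suc j) * \<bar>u (\<tau>' j)\<bar>)"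
    proof -
      have "(\<Sum>j=s..<n. lam (Suc j) * ord_abs n u (Suc j)) = 0"
        using ord_abs_permutation_support[OF \<pi> u] \<pi>(2) by (intro sum.neutral) auto
      moreover have "(\<Sum>j<s. lam (Suc j) * ord_abs n u (Suc j)) = (\<Sum>j<s. lam (Suc j) * \<bar>u (\<tau>' j)\<bar>)"
        using low \<pi>(2) s by (intro sum.cong) auto
      ultimately show ?thesis by (simp add: sorted_l1_altdef split)
    qed
    then have "sorted_l1 n lam u - (\<Sum>j<s. lam (Suc j) * \<bar>v (\<tau>' j)\<bar>)
        = (\<Sum>j<s. lam (Suc j) * (\<bar>u (\<tau>' j)\<bar> - \<bar>v (\<tau>' j)\<bar>))"
      by (simp add: sum_subtractf right_diff_distrib)
    also have "\<dots> \<le> (\<Sum>j<s. lam (Suc j) * \<bar>u (\<tau>' j) + v (\<tau>' j)\<bar>)"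
      using s nonneg by (intro sum_mono mult_left_mono) auto
    finally have 1: "sorted_l1 n lam u - (\<Sum>j<s. lam (Suc j) * \<bar>v (\<tau>' j)\<bar>) \<le> \<dots>" .
    have "(\<Sum>j=s..<n. lam (Suc j) * ord_abs n v (Suc j)) \<le> (\<Sum>j=s..<n. lam (Suc j) * \<bar>u (\<tau>' j) + v (\<tau>' j)\<bar>)"
      using high nonneg by (intro sum_mono mult_left_mono) auto
    with 1 show ?thesis by (simp add: split)
  qed
  \<comment> \<open>The sorted norm is the maximum over orders, so the particular order
    \<open>\<tau>'\<close> bounds it from below.\<close>
  also have "\<dots> \<le> sorted_l1 n lam (\<lambda>i. u i + v i)"
    unfolding sorted_l1_altdef by (rule sum_mult_permute_le_ord_abs[OF \<tau>']) (rule lam)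
  finally have *: "sorted_l1 n lam u - (\<Sum>j<s. lam (Suc j) * \<bar>v (\<tau>' j)\<bar>)
      + (\<Sum>j=s..<n. lam (Suc j) * ord_abs n v (Suc j)) \<le> sorted_l1 n lam (\<lambda>i. u i + v i)" .
  have "(\<Sum>j<s. (v (\<tau>' j))\<^sup>2) \<le> (\<Sum>j<n. (v (\<tau>' j))\<^sup>2)"
    using s by (intro sum_mono2) auto
  also have "\<dots> = sqnorm n v"
    unfolding sqnorm_def using sum.permute[OF \<tau>', of "\<lambda>i. (v i)\<^sup>2"] by (simp add: o_def)
  finally have "sqrt (\<Sum>j<s. \<bar>v (\<tau>' j)\<bar>\<^sup>2) \<le> l2 n v"
    by (simp add: l2_def)
  then have "(\<Sum>j<s. lam (Suc j) * \<bar>v (\<tau>' j)\<bar>) \<le> sqrt (\<Sum>j<s. (lam (Suc j))\<^sup>2) * l2 n v"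
    using cauchy_schwarz_sqrt_sum[of "\<lambda>j. lam (Suc j)" "\<lambda>j. \<bar>v (\<tau>' j)\<bar>" "{..<s}"]
    by (smt (verit) mult_left_mono real_sqrt_ge_zero sum_nonneg zero_le_power2)
  with * show ?thesis by simp
qed

section \<open>Gaussian tail bounds\<close>

text \<open>On the range of integration \<open>x / \<sigma>\<close> is at least 1. Inserting this
  factor gives an integrand with the explicit antiderivative
  \<open>- \<sigma> * normal_density 0 \<sigma> x\<close>, which vanishes at infinity. The factor
  one half comes from \<open>2 \<le> sqrt (2 * pi)\<close>.\<close>

lemma nn_integral_normal_upper_tail_le:
  assumes \<sigma>: "0 < \<sigma>" and t: "1 \<le> t"
  shows "(\<integral>\<^sup>+x. ennreal (normal_density 0 \<sigma> x) * indicator {\<sigma> * t..} x \<partial>lborel) \<le> ennreal (exp (- t\<^sup>2 / 2) / 2)"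
proof -
  let ?f = "\<lambda>x. x / \<sigma> * normal_density 0 \<sigma> x"
  have "(\<integral>\<^sup>+x. ennreal (normal_density 0 \<sigma> x) * indicator {\<sigma> * t..} x \<partial>lborel)
      \<le> (\<integral>\<^sup>+x. ennreal (?f x) * indicator {\<sigma> * t..} x \<partial>lborel)"
  proof (rule nn_integral_mono)
    fix x
    show "ennreal (normal_density 0 \<sigma> x) * indicator {\<sigma> * t..} x \<le> ennreal (?f x) * indicator {\<sigma> * t..} x"
    proof (cases "\<sigma> * t \<le> x")
      case True
      have "\<sigma> \<le> \<sigma> * t" using \<sigma> t by simp
      with True have "\<sigma> \<le> x" by simp
      then have "1 \<le> x / \<sigma>" using \<sigma> by simp
      then have "1 * normal_density 0 \<sigma> x \<le> ?f x" by (intro mult_right_mono) auto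
      then show ?thesis using True by (auto intro: ennreal_leI)
    qed auto
  qed
  also have "\<dots> = ennreal (0 - (- \<sigma> * normal_density 0 \<sigma> (\<sigma> * t)))"
  proof (rule nn_integral_FTC_atLeast)
    show "((\<lambda>x. - \<sigma> * normal_density 0 \<sigma> x) has_real_derivative ?f x) (at x)" for x
    proof -
      define c where "c = 1 / sqrt (2 * pi * \<sigma>\<^sup>2)"
      have nd: "normal_density 0 \<sigma> x = c * exp (- x\<^sup>2 / (2 * \<sigma>\<^sup>2))" for x
        by (simp add: normal_density_def c_def)
      have "((\<lambda>x. exp (- x\<^sup>2 / (2 * \<sigma>\<^sup>2))) has_real_derivative exp (- x\<^sup>2 / (2 * \<sigma>\<^sup>2)) * (- (2 * x) / (2 * \<sigma>\<^sup>2))) (at x)"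
        using \<sigma> by (auto intro!: derivative_eq_intros simp: field_simps power2_eq_square power4_eq_xxxx)
      from DERIV_cmult[OF this, of "- \<sigma> * c"] show ?thesis
        using \<sigma> by (simp add: nd power2_eq_square mult.assoc mult.commute mult.left_commute)
    qed
    show "0 \<le> ?f x" if "\<sigma> * t \<le> x" for x
      using that \<sigma> t by (smt (verit) divide_nonneg_pos mult_nonneg_nonneg normal_density_nonneg)
    have "((\<lambda>x. exp (- (x\<^sup>2 / (2 * \<sigma>\<^sup>2)))) \<longlongrightarrow> 0) at_top"
    proof (rule filterlim_compose[OF exp_at_bot])
      have "filterlim (\<lambda>x. x\<^sup>2 / (2 * \<sigma>\<^sup>2)) at_top at_top"
        unfolding divide_inverse using \<sigma>
        by (intro filterlim_at_top_mult_tendsto_pos[OF tendsto_const]) (auto intro: filterlim_pow_at_top filterlim_ident)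
      then show "filterlim (\<lambda>x. - (x\<^sup>2 / (2 * \<sigma>\<^sup>2))) at_bot at_top"
        by (simp add: filterlim_uminus_at_bot)
    qed
    then have "((\<lambda>x. - \<sigma> * (1 / sqrt (2 * pi * \<sigma>\<^sup>2) * exp (- (x\<^sup>2 / (2 * \<sigma>\<^sup>2))))) \<longlongrightarrow> - \<sigma> * (1 / sqrt (2 * pi * \<sigma>\<^sup>2) * 0)) at_top"
      by (intro tendsto_intros)
    then show "((\<lambda>x. - \<sigma> * normal_density 0 \<sigma> x) \<longlongrightarrow> 0) at_top"
      by (simp add: normal_density_def)
  qed auto
  also have "\<dots> \<le> ennreal (exp (- t\<^sup>2 / 2) / 2)"
  proof (rule ennreal_leI)
    have "sqrt 4 \<le> sqrt (2 * pi)" using pi_ge_two by (intro real_sqrt_le_mono) simp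
    then have "2 \<le> sqrt (2 * pi)" by simp
    then have "exp (- t\<^sup>2 / 2) / sqrt (2 * pi) \<le> exp (- t\<^sup>2 / 2) / 2"
      by (intro divide_left_mono) auto
    moreover have "0 - (- \<sigma> * normal_density 0 \<sigma> (\<sigma> * t)) = exp (- t\<^sup>2 / 2) / sqrt (2 * pi)"
      using \<sigma> by (simp add: normal_density_def real_sqrt_mult power_mult_distrib)
    ultimately show "0 - (- \<sigma> * normal_density 0 \<sigma> (\<sigma> * t)) \<le> exp (- t\<^sup>2 / 2) / 2" by simp
  qed
  finally show ?thesis .
qed

text \<open>The exponential halves the quadratic exponent of the density. The product is the normal
  density with variance \<open>2 * \<sigma>\<^sup>2\<close>, up to the ratio \<open>sqrt 2\<close>
  of the normalising constants.\<close>

lemma nn_integral_exp_square_normal: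
  assumes \<sigma>: "0 < \<sigma>"
  shows "(\<integral>\<^sup>+x. ennreal (exp (x\<^sup>2 / (4 * \<sigma>\<^sup>2))) \<partial>density lborel (normal_density 0 \<sigma>)) = ennreal (sqrt 2)"
proof -
  have eq: "normal_density 0 \<sigma> x * exp (x\<^sup>2 / (4 * \<sigma>\<^sup>2)) = sqrt 2 * normal_density 0 (sqrt 2 * \<sigma>) x" for x
  proof -
    have "- x\<^sup>2 / (2 * \<sigma>\<^sup>2) + x\<^sup>2 / (4 * \<sigma>\<^sup>2) = - x\<^sup>2 / (4 * \<sigma>\<^sup>2)"
      using \<sigma> by (simp add: field_simps)
    then have "exp (- x\<^sup>2 / (2 * \<sigma>\<^sup>2)) * exp (x\<^sup>2 / (4 * \<sigma>\<^sup>2)) = exp (- x\<^sup>2 / (4 * \<sigma>\<^sup>2))"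
      by (metis exp_add)
    then show ?thesis
      using \<sigma> by (simp add: normal_density_def real_sqrt_mult power_mult_distrib field_simps)
  qed
  interpret N: prob_space "density lborel (normal_density 0 (sqrt 2 * \<sigma>))"
    by (rule prob_space_normal_density) (use \<sigma> in simp)
  have "(\<integral>\<^sup>+x. ennreal (exp (x\<^sup>2 / (4 * \<sigma>\<^sup>2))) \<partial>density lborel (normal_density 0 \<sigma>))
      = (\<integral>\<^sup>+x. ennreal (sqrt 2) * ennreal (normal_density 0 (sqrt 2 * \<sigma>) x) \<partial>lborel)"
    by (simp add: nn_integral_density ennreal_mult[symmetric] eq)
  also have "\<dots> = ennreal (sqrt 2) * (\<integral>\<^sup>+x. ennreal (normal_density 0 (sqrt 2 * \<sigma>) x) \<partial>lborel)"
    by (rule nn_integral_cmult) auto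
  also have "(\<integral>\<^sup>+x. ennreal (normal_density 0 (sqrt 2 * \<sigma>) x) \<partial>lborel) = 1"
    using N.emeasure_space_1 by (simp add: emeasure_density)
  finally show ?thesis by simp
qed

section \<open>Coordinates, linear forms and sums of squares of the Gaussian vector\<close>

lemma prob_space_gauss_vec: "0 < \<sigma> \<Longrightarrow> prob_space (gauss_vec n \<sigma>)"
  unfolding gauss_vec_def by (intro prob_space_PiM prob_space_normal_density)

lemma measurable_gauss_vec_component [measurable]:
  "i < n \<Longrightarrow> (\<lambda>\<epsilon>. \<epsilon> i) \<in> borel_measurable (gauss_vec n \<sigma>)"
  unfolding gauss_vec_def by (rule measurable_compose[OF measurable_component_singleton]) auto

lemma measurable_gauss_vec_linear:
  "(\<lambda>\<epsilon>. \<Sum>i<n. a i * \<epsilon> i) \<in> borel_measurable (gauss_vec n \<sigma>)"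
  by (intro borel_measurable_sum borel_measurable_times) auto

lemma measurable_gauss_vec_sum_squares:
  "I \<subseteq> {..<n} \<Longrightarrow> (\<lambda>\<epsilon>. \<Sum>i\<in>I. (\<epsilon> i)\<^sup>2) \<in> borel_measurable (gauss_vec n \<sigma>)"
  by (intro borel_measurable_sum borel_measurable_power) auto

lemma distributed_gauss_vec_component:
  assumes "0 < \<sigma>" "i < n"
  shows "distributed (gauss_vec n \<sigma>) lborel (\<lambda>\<epsilon>. \<epsilon> i) (normal_density 0 \<sigma>)"
proof -
  have "distr (gauss_vec n \<sigma>) lborel (\<lambda>\<epsilon>. \<epsilon> i)
      = distr (gauss_vec n \<sigma>) (density lborel (normal_density 0 \<sigma>)) (\<lambda>\<epsilon>. \<epsilon> i)"
    by (intro distr_cong) auto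
  also have "\<dots> = density lborel (normal_density 0 \<sigma>)"
    unfolding gauss_vec_def using assms
    by (subst distr_PiM_component) (auto intro: prob_space_normal_density)
  finally show ?thesis
    using assms by (auto simp: distributed_def)
qed

text \<open>Independence means that the joint law is the product of the marginals. Points of the
  product space are extensional, so the joint map is the identity and the joint law is the product
  measure itself.\<close>

lemma indep_vars_gauss_vec:
  assumes \<sigma>: "0 < \<sigma>" and n: "0 < n"
  shows "prob_space.indep_vars (gauss_vec n \<sigma>) (\<lambda>_. borel) (\<lambda>i \<epsilon>. \<epsilon> i) {..<n}"
proof -
  let ?N = "density lborel (normal_density 0 \<sigma>)"
  interpret prob_space "gauss_vec n \<sigma>" by (rule prob_space_gauss_vec[OF \<sigma>])
  have "indep_vars (\<lambda>_. ?N) (\<lambda>i \<epsilon>. \<epsilon> i) {..<n}"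
  proof (subst indep_vars_iff_distr_eq_PiM')
    show "{..<n} \<noteq> {}" using n by auto
    show "random_variable ?N (\<lambda>\<epsilon>. \<epsilon> i)" if "i \<in> {..<n}" for i
      unfolding gauss_vec_def using that by (rule measurable_component_singleton)
    have "distr (gauss_vec n \<sigma>) (\<Pi>\<^sub>M i\<in>{..<n}. ?N) (\<lambda>x. \<lambda>i\<in>{..<n}. x i)
        = distr (gauss_vec n \<sigma>) (gauss_vec n \<sigma>) (\<lambda>x. x)"
    proof (rule distr_cong)
      show "restrict x {..<n} = x" if "x \<in> space (gauss_vec n \<sigma>)" for x
        using that by (auto simp: gauss_vec_def space_PiM PiE_def extensional_restrict)
    qed (auto simp: gauss_vec_def)
    also have "\<dots> = gauss_vec n \<sigma>" by (rule distr_id)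
    also have "\<dots> = (\<Pi>\<^sub>M i\<in>{..<n}. distr (gauss_vec n \<sigma>) ?N (\<lambda>\<epsilon>. \<epsilon> i))"
      unfolding gauss_vec_def
      by (intro PiM_cong refl distr_PiM_component[symmetric] prob_space_normal_density \<sigma>) auto
    finally show "distr (gauss_vec n \<sigma>) (\<Pi>\<^sub>M i\<in>{..<n}. ?N) (\<lambda>x. \<lambda>i\<in>{..<n}. x i)
        = (\<Pi>\<^sub>M i\<in>{..<n}. distr (gauss_vec n \<sigma>) ?N (\<lambda>\<epsilon>. \<epsilon> i))" .
  qed
  then show ?thesis
    by (rule indep_vars_compose2[where Y = "\<lambda>_ x. x"]) auto
qed

lemma distributed_gauss_vec_linear:
  assumes \<sigma>: "0 < \<sigma>" and a: "(\<Sum>i<n. (a i)\<^sup>2) = 1"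
  shows "distributed (gauss_vec n \<sigma>) lborel (\<lambda>\<epsilon>. \<Sum>i<n. a i * \<epsilon> i) (normal_density 0 \<sigma>)"
proof -
  interpret prob_space "gauss_vec n \<sigma>" by (rule prob_space_gauss_vec[OF \<sigma>])
  \<comment> \<open>Zero coefficients are removed, since the sum rule for independent normal
    variables requires positive standard deviations.\<close>
  define I where "I = {i \<in> {..<n}. a i \<noteq> 0}"
  have sumI: "(\<Sum>i<n. f i) = (\<Sum>i\<in>I. f i)" if "\<And>i. a i = 0 \<Longrightarrow> f i = 0" for f :: "nat \<Rightarrow> real"
    using that by (intro sum.mono_neutral_right) (auto simp: I_def)
  have n: "0 < n" using a by (cases n) auto
  have ne: "I \<noteq> {}" using a sumI[of "\<lambda>i. (a i)\<^sup>2"] by auto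
  have "distributed (gauss_vec n \<sigma>) lborel (\<lambda>\<epsilon>. \<Sum>i\<in>I. a i * \<epsilon> i)
      (normal_density (\<Sum>i\<in>I. 0) (sqrt (\<Sum>i\<in>I. (\<bar>a i\<bar> * \<sigma>)\<^sup>2)))"
  proof (rule sum_indep_normal)
    show "indep_vars (\<lambda>_. borel) (\<lambda>i \<epsilon>. a i * \<epsilon> i) I"
      by (rule indep_vars_subset[OF indep_vars_compose2[OF indep_vars_gauss_vec[OF \<sigma> n], where Y = "\<lambda>i x. a i * x"]])
        (auto simp: I_def)
    show "distributed (gauss_vec n \<sigma>) lborel (\<lambda>\<epsilon>. a i * \<epsilon> i) (normal_density 0 (\<bar>a i\<bar> * \<sigma>))" if "i \<in> I" for i
      using normal_density_affine[OF distributed_gauss_vec_component[OF \<sigma>, of i n] \<sigma>, of "a i" 0] that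
      by (auto simp: I_def)
  qed (use ne \<sigma> in \<open>auto simp: I_def\<close>)
  moreover have "(\<Sum>i\<in>I. (\<bar>a i\<bar> * \<sigma>)\<^sup>2) = \<sigma>\<^sup>2"
    using a sumI[of "\<lambda>i. (a i)\<^sup>2"] by (simp add: power_mult_distrib sum_distrib_right[symmetric])
  ultimately show ?thesis
    using \<sigma> by (simp add: sumI)
qed

lemma gauss_vec_linear_tail:
  assumes \<sigma>: "0 < \<sigma>" and a: "(\<Sum>i<n. (a i)\<^sup>2) = 1" and t: "1 \<le> t"
  shows "measure (gauss_vec n \<sigma>) {\<epsilon> \<in> space (gauss_vec n \<sigma>). \<sigma> * t < \<bar>\<Sum>i<n. a i * \<epsilon> i\<bar>} \<le> exp (- t\<^sup>2 / 2)"
proof -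
  interpret prob_space "gauss_vec n \<sigma>" by (rule prob_space_gauss_vec[OF \<sigma>])
  let ?U = "\<lambda>b. (\<lambda>\<epsilon>. \<Sum>i<n. b i * \<epsilon> i) -` {\<sigma> * t..} \<inter> space (gauss_vec n \<sigma>)"
  have one: "prob (?U b) \<le> exp (- t\<^sup>2 / 2) / 2" if "(\<Sum>i<n. (b i)\<^sup>2) = 1" for b
  proof -
    have "ennreal (prob (?U b)) \<le> ennreal (exp (- t\<^sup>2 / 2) / 2)"
      using distributed_emeasure[OF distributed_gauss_vec_linear[OF \<sigma> that], of "{\<sigma> * t..}"]
        nn_integral_normal_upper_tail_le[OF \<sigma> t] by (simp add: emeasure_eq_measure)
    then show ?thesis by simp
  qed
  have meas: "?U b \<in> events" for b
    using measurable_gauss_vec_linear by (rule measurable_sets) auto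
  have "prob {\<epsilon> \<in> space (gauss_vec n \<sigma>). \<sigma> * t < \<bar>\<Sum>i<n. a i * \<epsilon> i\<bar>} \<le> prob (?U a \<union> ?U (\<lambda>i. - a i))"
    using meas by (intro finite_measure_mono) (auto simp: sum_negf)
  also have "\<dots> \<le> prob (?U a) + prob (?U (\<lambda>i. - a i))"
    by (intro measure_Un_le meas)
  also have "\<dots> \<le> exp (- t\<^sup>2 / 2)"
    using one[OF a] one[of "\<lambda>i. - a i"] a by simp
  finally show ?thesis .
qed

text \<open>Chernoff bound with parameter \<open>1 / (4 * \<sigma>\<^sup>2)\<close>: the exponential
  moment factorises over the coordinates, and each coordinate in \<open>I\<close> contributes
  \<open>sqrt 2\<close>.\<close>

lemma gauss_vec_sum_squares_tail:
  assumes \<sigma>: "0 < \<sigma>" and I: "I \<subseteq> {..<n}"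
  shows "measure (gauss_vec n \<sigma>) {\<epsilon> \<in> space (gauss_vec n \<sigma>). r * \<sigma>\<^sup>2 < (\<Sum>i\<in>I. (\<epsilon> i)\<^sup>2)}
    \<le> sqrt 2 ^ card I * exp (- r / 4)"
proof -
  let ?M = "gauss_vec n \<sigma>" and ?N = "density lborel (normal_density 0 \<sigma>)"
  interpret prob_space ?M by (rule prob_space_gauss_vec[OF \<sigma>])
  interpret N: prob_space ?N by (rule prob_space_normal_density[OF \<sigma>])
  interpret P: product_sigma_finite "\<lambda>_::nat. ?N" by standard
  note [measurable] = measurable_gauss_vec_sum_squares[OF I, of \<sigma>]
  \<comment> \<open>The value 1 off \<open>I\<close> lets the product run over all coordinates of
    the product measure.\<close>
  define f :: "nat \<Rightarrow> real \<Rightarrow> ennreal" where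
    "f i x = (if i \<in> I then ennreal (exp (x\<^sup>2 / (4 * \<sigma>\<^sup>2))) else 1)" for i x
  have fin: "finite I" using I by (rule finite_subset) simp
  have "(\<integral>\<^sup>+\<epsilon>. (\<Prod>i<n. f i (\<epsilon> i)) \<partial>?M) = (\<Prod>i<n. \<integral>\<^sup>+x. f i x \<partial>?N)"
    unfolding gauss_vec_def by (rule P.product_nn_integral_prod) (auto simp: f_def)
  also have "\<dots> = (\<Prod>i<n. if i \<in> I then ennreal (sqrt 2) else 1)"
    using nn_integral_exp_square_normal[OF \<sigma>] N.emeasure_space_1 by (intro prod.cong) (auto simp: f_def)
  also have "\<dots> = ennreal (sqrt 2 ^ card I)"
    using I by (simp add: prod.If_cases Int_absorb1 ennreal_power)
  finally have int: "(\<integral>\<^sup>+\<epsilon>. (\<Prod>i<n. f i (\<epsilon> i)) \<partial>?M) = ennreal (sqrt 2 ^ card I)" .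
  have prod: "(\<Prod>i<n. f i (\<epsilon> i)) = ennreal (exp ((\<Sum>i\<in>I. (\<epsilon> i)\<^sup>2) / (4 * \<sigma>\<^sup>2)))" for \<epsilon>
    using I fin by (simp add: f_def prod.If_cases Int_absorb1 prod_ennreal exp_sum[symmetric] sum_divide_distrib)
  have "emeasure ?M {\<epsilon> \<in> space ?M. r * \<sigma>\<^sup>2 < (\<Sum>i\<in>I. (\<epsilon> i)\<^sup>2)}
      \<le> emeasure ?M {\<epsilon> \<in> space ?M. 1 \<le> ennreal (exp (- r / 4)) * ennreal (exp ((\<Sum>i\<in>I. (\<epsilon> i)\<^sup>2) / (4 * \<sigma>\<^sup>2)))}"
  proof (rule emeasure_mono)
    show "{\<epsilon> \<in> space ?M. r * \<sigma>\<^sup>2 < (\<Sum>i\<in>I. (\<epsilon> i)\<^sup>2)} \<subseteq>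
      {\<epsilon> \<in> space ?M. 1 \<le> ennreal (exp (- r / 4)) * ennreal (exp ((\<Sum>i\<in>I. (\<epsilon> i)\<^sup>2) / (4 * \<sigma>\<^sup>2)))}"
    proof (intro subsetI CollectI conjI; clarify)
      fix \<epsilon> assume "r * \<sigma>\<^sup>2 < (\<Sum>i\<in>I. (\<epsilon> i)\<^sup>2)"
      then have "0 \<le> - r / 4 + (\<Sum>i\<in>I. (\<epsilon> i)\<^sup>2) / (4 * \<sigma>\<^sup>2)"
        using \<sigma> by (simp add: field_simps)
      then have "1 \<le> exp (- r / 4 + (\<Sum>i\<in>I. (\<epsilon> i)\<^sup>2) / (4 * \<sigma>\<^sup>2))" by simp
      then show "1 \<le> ennreal (exp (- r / 4)) * ennreal (exp ((\<Sum>i\<in>I. (\<epsilon> i)\<^sup>2) / (4 * \<sigma>\<^sup>2)))"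
        by (simp add: ennreal_mult[symmetric] exp_add[symmetric])
    qed
  qed measurable
  also have "\<dots> \<le> ennreal (exp (- r / 4)) *
      (\<integral>\<^sup>+\<epsilon>. ennreal (exp ((\<Sum>i\<in>I. (\<epsilon> i)\<^sup>2) / (4 * \<sigma>\<^sup>2))) * indicator (space ?M) \<epsilon> \<partial>?M)"
    by (rule nn_integral_Markov_inequality) measurable
  also have "(\<integral>\<^sup>+\<epsilon>. ennreal (exp ((\<Sum>i\<in>I. (\<epsilon> i)\<^sup>2) / (4 * \<sigma>\<^sup>2))) * indicator (space ?M) \<epsilon> \<partial>?M)
      = ennreal (sqrt 2 ^ card I)"
    unfolding int[symmetric] prod by (intro nn_integral_cong) auto
  finally show ?thesis
    by (simp add: emeasure_eq_measure ennreal_mult[symmetric] mult.commute)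
qed

section \<open>The noise event\<close>

text \<open>The left side divided by \<open>fact j\<close> is a single term of the exponential
  series at \<open>j\<close>. This replaces Stirling's formula in the two estimates that
  follow.\<close>

lemma power_self_le_exp_mult_fact: "real j ^ j \<le> exp (real j) * fact j"
proof -
  have "(\<Sum>i\<in>{j}. inverse (fact i) * real j ^ i) \<le> (\<Sum>i. inverse (fact i) * real j ^ i)"
    by (intro sum_le_suminf summable_exp) auto
  then have "real j ^ j / fact j \<le> exp (real j)"
    by (simp add: exp_def field_simps)
  then show ?thesis by (simp add: field_simps)
qed

lemma binomial_le_exp:
  assumes "0 < j" "0 < n"
  shows "real (n choose j) \<le> exp (j * (1 + ln (n / j)))"
proof -
  have "real (n choose j) * fact j \<le> real n ^ j"
    using binomial_fact_pow[of n j] by (metis of_nat_fact of_nat_le_iff of_nat_mult of_nat_power)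
  then have "real (n choose j) * real j ^ j * fact j \<le> exp (real j) * real n ^ j * fact j"
    using mult_mono[OF _ power_self_le_exp_mult_fact[of j], of "real (n choose j) * fact j" "real n ^ j"]
    by (simp add: mult_ac)
  then have "real (n choose j) * real j ^ j \<le> exp (real j) * real n ^ j"
    by simp
  then have "real (n choose j) \<le> exp (real j) * (real n / real j) ^ j"
    using assms by (simp add: field_simps)
  also have "(real n / real j) ^ j = exp (j * ln (n / j))"
    using assms by (simp add: exp_of_nat_mult)
  finally show ?thesis
    by (simp add: exp_add[symmetric] distrib_left)
qed

text \<open>The sum telescopes to \<open>s * ln (2 * n) - ln (fact s)\<close>, and
  \<open>fact s\<close> is at least \<open>(s / e) ^ s\<close>.\<close>

lemma sum_ln_ratio_le:
  assumes "0 < n" "0 < s"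
  shows "(\<Sum>j=1..s. ln (2 * real n / real j)) \<le> s * ln (2 * exp 1 * n / s)"
proof -
  have eq: "(\<Sum>j=1..m. ln (2 * real n / real j)) = m * ln (2 * real n) - ln (fact m)" for m
  proof (induction m)
    case (Suc m)
    have "ln (fact (Suc m) :: real) = ln (real (Suc m)) + ln (fact m)"
      unfolding fact_Suc by (subst ln_mult) auto
    moreover have "ln (2 * real n / real (Suc m)) = ln (2 * real n) - ln (real (Suc m))"
      using assms by (subst ln_div) auto
    ultimately show ?case using Suc.IH by (simp add: distrib_right)
  qed simp
  have "ln (real s ^ s) \<le> ln (exp (real s) * fact s)"
    using power_self_le_exp_mult_fact[of s] assms by (subst ln_le_cancel_iff) auto
  then have "s * ln (real s) \<le> s + ln (fact s)"
    by (simp add: ln_realpow ln_mult)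
  moreover have "ln (2 * exp 1 * n / s) = ln (2 * real n) + 1 - ln s"
    using assms by (simp add: ln_div ln_mult)
  then have "s * ln (2 * exp 1 * n / s) = s * ln (2 * real n) + s - s * ln s"
    by (simp add: distrib_left right_diff_distrib)
  ultimately show ?thesis
    unfolding eq by linarith
qed

text \<open>The three factors have total exponent at most
  \<open>- 6 * f j + j * (1 - ln 2 / 2)\<close>. Of the six copies of \<open>f j\<close>, one pays
  for the linear term, two for \<open>j * ln 4\<close> and three for \<open>f s\<close>.\<close>

lemma card_weighted_tail_le:
  assumes s: "0 < s" "s \<le> j" "j \<le> n"
  shows "real (n choose j) * (sqrt 2 ^ j * exp (- ((4 + sqrt 2)\<^sup>2 * (real j * ln (2 * real n / real j))) / 4))
    \<le> (real s / (2 * real n)) ^ s * (1 / 4) ^ j"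
proof -
  define f where "f i = real i * ln (2 * n / i)" for i :: nat
  have pos: "0 < real j" "0 < real n" "0 < real s" using s by auto
  have "sqrt (25/16) \<le> sqrt 2" by (intro real_sqrt_le_mono) simp
  then have "5 / 4 \<le> sqrt 2" by (simp add: real_sqrt_divide)
  \<comment> \<open>The square is \<open>18 + 8 * sqrt 2\<close>. Division by 4 leaves the exponent
    \<open>- 7 * f j\<close>, of which the binomial coefficient takes one copy.\<close>
  then have C: "28 \<le> (4 + sqrt 2)\<^sup>2" by (simp add: power2_sum)
  have fj: "j * ln 2 \<le> f j"
    unfolding f_def using s by (intro mult_left_mono) (auto simp: field_simps)
  have ln2: "2 / 3 \<le> ln (2::real)" by (rule ln2_ge_two_thirds)
  have j: "j * (1 - ln 2 / 2) \<le> f j" "j / 2 \<le> f j"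
    using mult_left_mono[of "1 - ln 2 / 2" "ln 2" "real j"] mult_left_mono[of "1 / 2" "ln 2" "real j"] fj ln2
    by auto
  then have f0: "0 \<le> f j" using pos by linarith
  \<comment> \<open>\<open>f\<close> is not monotone: it decreases beyond \<open>2 * n / e\<close>.
    Splitting the logarithm costs at most \<open>j - s\<close> on top of \<open>f j\<close>, and
    \<open>j \<le> 2 * f j\<close>.\<close>
  have fs: "f s \<le> 3 * f j"
  proof -
    have "ln (2 * n / s) = ln (2 * n / j) + ln (j / s)"
      using pos by (simp add: ln_div)
    moreover have "s * ln (j / s) \<le> s * (j / s - 1)"
      using pos by (intro mult_left_mono ln_le_minus_one) auto
    moreover have "0 \<le> ln (2 * n / j)"
      using s by (intro ln_ge_zero) (simp add: field_simps)
    then have "s * ln (2 * n / j) \<le> f j"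
      unfolding f_def using s by (intro mult_right_mono) auto
    ultimately have "f s \<le> f j + s * (j / s - 1)"
      unfolding f_def by (simp add: distrib_left)
    also have "s * (j / s - 1) = real j - s" using pos by (simp add: field_simps)
    finally show ?thesis using j pos by simp
  qed
  have "real (n choose j) \<le> exp (f j + j * (1 - ln 2))"
  proof -
    have "j * (1 + ln (n / j)) = f j + j * (1 - ln 2)"
      unfolding f_def using pos by (simp add: ln_div ln_mult algebra_simps)
    then show ?thesis using binomial_le_exp[of j n] pos by simp
  qed
  moreover have "sqrt 2 ^ j = exp (j * (ln 2 / 2))"
    by (simp add: exp_of_nat_mult ln_sqrt[symmetric])
  moreover have "exp (- ((4 + sqrt 2)\<^sup>2 * f j) / 4) \<le> exp (- 7 * f j)"
    using mult_right_mono[OF C f0] by simp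
  ultimately have "real (n choose j) * (sqrt 2 ^ j * exp (- ((4 + sqrt 2)\<^sup>2 * f j) / 4))
      \<le> exp (f j + j * (1 - ln 2)) * (exp (j * (ln 2 / 2)) * exp (- 7 * f j))"
    by (intro mult_mono) auto
  also have "\<dots> = exp (- 6 * f j + j * (1 - ln 2 / 2))"
    by (simp add: exp_add[symmetric] algebra_simps)
  also have "\<dots> \<le> exp (- f s + j * (- ln 4))"
  proof -
    have "ln (4::real) = 2 * ln 2"
      using ln_realpow[of 2 2] by simp
    then have "j * ln 4 \<le> 2 * f j" using fj by simp
    then show ?thesis using j(1) fs by simp
  qed
  also have "\<dots> = (s / (2 * n)) ^ s * (1 / 4) ^ j"
  proof -
    have "exp (- ln (2 * n / s)) = s / (2 * n)"
      using pos by (simp add: exp_minus)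
    then have "exp (- f s) = (s / (2 * n)) ^ s"
      unfolding f_def by (metis exp_of_nat_mult mult_minus_right)
    moreover have "exp (j * (- ln 4)) = (1 / 4 :: real) ^ j"
      unfolding exp_of_nat_mult by (simp add: exp_minus inverse_eq_divide)
    ultimately show ?thesis by (simp only: exp_add)
  qed
  finally show ?thesis by (simp add: f_def)
qed

lemma gauss_vec_sum_squares_event:
  assumes \<sigma>: "0 < \<sigma>" and s: "0 < s" "s \<le> n"
  defines "B \<equiv> \<lambda>I. {\<epsilon> \<in> space (gauss_vec n \<sigma>).
    (4 + sqrt 2)\<^sup>2 * (card I * ln (2 * real n / card I)) * \<sigma>\<^sup>2 < (\<Sum>i\<in>I. (\<epsilon> i)\<^sup>2)}"
  shows "measure (gauss_vec n \<sigma>) (\<Union>I\<in>{I. I \<subseteq> {..<n} \<and> s \<le> card I}. B I) \<le> 1 / 2 * (real s / (2 * real n)) ^ s"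
    and "(\<Union>I\<in>{I. I \<subseteq> {..<n} \<and> s \<le> card I}. B I) \<in> sets (gauss_vec n \<sigma>)"
proof -
  let ?M = "gauss_vec n \<sigma>" and ?P = "{I. I \<subseteq> {..<n} \<and> s \<le> card I}"
  let ?g = "\<lambda>j. sqrt 2 ^ j * exp (- ((4 + sqrt 2)\<^sup>2 * (real j * ln (2 * real n / real j))) / 4)"
  interpret prob_space ?M by (rule prob_space_gauss_vec[OF \<sigma>])
  have fin: "finite ?P" by simp
  have meas: "B I \<in> events" if "I \<in> ?P" for I
  proof -
    have [measurable]: "(\<lambda>\<epsilon>. \<Sum>i\<in>I. (\<epsilon> i)\<^sup>2) \<in> borel_measurable ?M"
      using that by (intro measurable_gauss_vec_sum_squares) simp
    show ?thesis unfolding B_def by measurable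
  qed
  show "(\<Union>I\<in>?P. B I) \<in> events"
    using fin meas by (rule sets.finite_UN)
  have P: "?P = (\<Union>j\<in>{s..n}. {I. I \<subseteq> {..<n} \<and> card I = j})"
    using card_mono[of "{..<n}"] by fastforce
  have "prob (\<Union>I\<in>?P. B I) \<le> (\<Sum>I\<in>?P. prob (B I))"
    using fin meas by (rule measure_UNION_le)
  also have "\<dots> \<le> (\<Sum>I\<in>?P. ?g (card I))"
    unfolding B_def by (rule sum_mono, rule gauss_vec_sum_squares_tail[OF \<sigma>]) simp
  also have "\<dots> = (\<Sum>j=s..n. \<Sum>I\<in>{I. I \<subseteq> {..<n} \<and> card I = j}. ?g (card I))"
    unfolding P by (rule sum.UNION_disjoint) auto
  also have "\<dots> = (\<Sum>j=s..n. real (n choose j) * ?g j)"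
    by (intro sum.cong refl) (simp add: n_subsets)
  also have "\<dots> \<le> (\<Sum>j=s..n. (real s / (2 * real n)) ^ s * (1 / 4) ^ j)"
    using s by (intro sum_mono card_weighted_tail_le[OF s(1)]) simp_all
  also have "\<dots> \<le> (real s / (2 * real n)) ^ s * (1 / 2)"
  proof -
    \<comment> \<open>Since \<open>s\<close> is positive, the geometric series starts at 1 at the
      earliest and stays below one third.\<close>
    have "(\<Sum>j=s..n. (1 / 4 :: real) ^ j) \<le> (\<Sum>j=1..n. (1 / 4) ^ j)"
      using s by (intro sum_mono2) auto
    also have "\<dots> = 1 / 3 - (1 / 4) ^ n / 3"
      by (induction n) (simp_all add: power_one_over)
    also have "\<dots> \<le> 1 / 2" by (simp add: field_simps add_increasing)
    finally show ?thesis
      unfolding sum_distrib_left[symmetric] by (intro mult_left_mono) auto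
  qed
  finally show "prob (\<Union>I\<in>?P. B I) \<le> 1 / 2 * (real s / (2 * real n)) ^ s" by simp
qed

text \<open>The threshold is half of the penalty level \<open>\<nu>\<close> used later. Columns have
  unit norm, so each exceeds it with probability at most \<open>1 / p\<^sup>2\<close>, and there are
  \<open>p\<close> of them. The bound on \<open>ln p\<close> puts the threshold in the range of the
  tail bound.\<close>

lemma gauss_vec_columns_event:
  fixes X :: "nat \<Rightarrow> nat \<Rightarrow> real"
  assumes \<sigma>: "0 < \<sigma>" and cols: "\<forall>j<p. (\<Sum>i<n. (X i j)\<^sup>2) = 1" and p: "1 \<le> ln (real p)"
  defines "B \<equiv> \<lambda>j. {\<epsilon> \<in> space (gauss_vec n \<sigma>). 2 * \<sigma> * sqrt (ln p) < \<bar>\<Sum>i<n. X i j * \<epsilon> i\<bar>}"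
  shows "measure (gauss_vec n \<sigma>) (\<Union>j<p. B j) \<le> 1 / p"
    and "(\<Union>j<p. B j) \<in> sets (gauss_vec n \<sigma>)"
proof -
  let ?M = "gauss_vec n \<sigma>"
  interpret prob_space ?M by (rule prob_space_gauss_vec[OF \<sigma>])
  have p0: "0 < real p" using p by (cases p) auto
  have meas: "B j \<in> events" for j
  proof -
    note [measurable] = measurable_gauss_vec_linear[of "\<lambda>i. X i j" n \<sigma>]
    show ?thesis unfolding B_def by measurable
  qed
  then show "(\<Union>j<p. B j) \<in> events" by auto
  have "1 \<le> sqrt (ln p)" using p by simp
  then have t: "1 \<le> 2 * sqrt (ln p)" by linarith
  have e: "exp (- (2 * sqrt (ln p))\<^sup>2 / 2) = 1 / (real p)\<^sup>2"
  proof -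
    have "- (2 * sqrt (ln p))\<^sup>2 / 2 = - (2 * ln p)" using p by (simp add: power_mult_distrib)
    then show ?thesis
      using p0 by (simp add: exp_minus exp_double inverse_eq_divide)
  qed
  have "prob (B j) \<le> 1 / (real p)\<^sup>2" if "j < p" for j
    using gauss_vec_linear_tail[OF \<sigma> _ t, of "\<lambda>i. X i j" n] cols that
    unfolding B_def e by (simp add: mult_ac)
  then have "(\<Sum>j<p. prob (B j)) \<le> (\<Sum>j<p. 1 / (real p)\<^sup>2)"
    by (intro sum_mono) auto
  also have "\<dots> = 1 / p" using p0 by (simp add: power2_eq_square)
  finally show "prob (\<Union>j<p. B j) \<le> 1 / p"
    using measure_UNION_le[of "{..<p}" B ?M] meas by fastforce
qed

section \<open>The deterministic estimate\<close>

text \<open>After both vectors are sorted, the first \<open>s\<close> positions are treated by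
  Cauchy-Schwarz. There \<open>s\<close> copies of \<open>lam s\<close> are dominated by the first
  \<open>s\<close> weights, as the weights decrease. Later positions are treated one by one.\<close>

lemma inner_n_le_sorted:
  fixes e v lam :: "nat \<Rightarrow> real" and C :: real
  assumes lam: "\<And>i j. i \<le> j \<Longrightarrow> j < n \<Longrightarrow> lam (Suc j) \<le> lam (Suc i)"
    and nonneg: "\<And>j. j < n \<Longrightarrow> 0 \<le> lam (Suc j)"
    and s: "0 < s" "s \<le> n" and C: "0 \<le> C"
    and ev: "\<And>I. I \<subseteq> {..<n} \<Longrightarrow> s \<le> card I \<Longrightarrow> (\<Sum>i\<in>I. (e i)\<^sup>2) \<le> card I * (C * lam (card I))\<^sup>2"
  shows "inner_n n e v \<le> C * (sqrt (\<Sum>j<s. (lam (Suc j))\<^sup>2) * l2 n v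
    + (\<Sum>j=s..<n. lam (Suc j) * ord_abs n v (Suc j)))"
proof -
  obtain \<pi> where \<pi>: "\<pi> permutes {..<n}" "\<And>j. j < n \<Longrightarrow> ord_abs n e (Suc j) = \<bar>e (\<pi> j)\<bar>"
    using ord_abs_permutation[of n e] by metis
  obtain \<omega> where \<omega>: "\<omega> permutes {..<n}" "\<And>j. j < n \<Longrightarrow> ord_abs n v (Suc j) = \<bar>v (\<omega> j)\<bar>"
    using ord_abs_permutation[of n v] by metis
  have top: "(\<Sum>j<m. (ord_abs n e (Suc j))\<^sup>2) \<le> m * (C * lam m)\<^sup>2" if m: "s \<le> m" "m \<le> n" for m
  proof -
    have inj: "inj_on \<pi> {..<m}"
      using permutes_inj[OF \<pi>(1)] by (rule inj_on_subset) simp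
    have "(\<Sum>j<m. (ord_abs n e (Suc j))\<^sup>2) = (\<Sum>j<m. (e (\<pi> j))\<^sup>2)"
      using m \<pi>(2) by (intro sum.cong) auto
    also have "\<dots> = (\<Sum>i\<in>\<pi> ` {..<m}. (e i)\<^sup>2)"
      using inj by (simp add: sum.reindex)
    also have "\<dots> \<le> card (\<pi> ` {..<m}) * (C * lam (card (\<pi> ` {..<m})))\<^sup>2"
    proof (rule ev)
      have "\<pi> ` {..<m} \<subseteq> \<pi> ` {..<n}" using m by (intro image_mono) auto
      then show "\<pi> ` {..<m} \<subseteq> {..<n}" using permutes_image[OF \<pi>(1)] by simp
    qed (use m inj in \<open>simp add: card_image\<close>)
    finally show ?thesis using inj by (simp add: card_image)
  qed
  have "inner_n n e v = (\<Sum>j<n. e (\<omega> j) * v (\<omega> j))"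
    unfolding inner_n_def using sum.permute[OF \<omega>(1), of "\<lambda>i. e i * v i"] by (simp add: o_def)
  also have "\<dots> \<le> (\<Sum>j<n. ord_abs n v (Suc j) * \<bar>e (\<omega> j)\<bar>)"
  proof (rule sum_mono)
    fix j assume "j \<in> {..<n}"
    then show "e (\<omega> j) * v (\<omega> j) \<le> ord_abs n v (Suc j) * \<bar>e (\<omega> j)\<bar>"
      using abs_ge_self[of "e (\<omega> j) * v (\<omega> j)"] by (simp add: \<omega>(2) abs_mult mult.commute)
  qed
  also have "\<dots> \<le> (\<Sum>j<n. ord_abs n v (Suc j) * ord_abs n e (Suc j))"
    by (rule sum_mult_permute_le_ord_abs[OF \<omega>(1) ord_abs_antimono])
  also have "\<dots> = (\<Sum>j<s. ord_abs n e (Suc j) * ord_abs n v (Suc j))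
      + (\<Sum>j=s..<n. ord_abs n e (Suc j) * ord_abs n v (Suc j))"
    by (simp add: sum_lessThan_split[OF s(2)] mult.commute)
  also have "\<dots> \<le> C * sqrt (\<Sum>j<s. (lam (Suc j))\<^sup>2) * l2 n v
      + (\<Sum>j=s..<n. C * lam (Suc j) * ord_abs n v (Suc j))"
  proof (intro add_mono sum_mono)
    have "(\<Sum>j<s. (ord_abs n e (Suc j))\<^sup>2) \<le> s * (C * lam s)\<^sup>2"
      using top[of s] s by simp
    also have "\<dots> = (\<Sum>j<s. (C * lam s)\<^sup>2)" by simp
    also have "\<dots> \<le> (\<Sum>j<s. (C * lam (Suc j))\<^sup>2)"
    proof (rule sum_mono, rule power_mono, rule mult_left_mono[OF _ C])
      fix j assume "j \<in> {..<s}"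
      then show "lam s \<le> lam (Suc j)" using lam[of j "s - 1"] s by simp
      show "0 \<le> C * lam s" using C nonneg[of "s - 1"] s by simp
    qed
    also have "\<dots> = C\<^sup>2 * (\<Sum>j<s. (lam (Suc j))\<^sup>2)"
      by (simp add: power_mult_distrib sum_distrib_left)
    finally have "sqrt (\<Sum>j<s. (ord_abs n e (Suc j))\<^sup>2) \<le> sqrt (C\<^sup>2 * (\<Sum>j<s. (lam (Suc j))\<^sup>2))"
      by (rule real_sqrt_le_mono)
    also have "\<dots> = C * sqrt (\<Sum>j<s. (lam (Suc j))\<^sup>2)"
      using C by (simp add: real_sqrt_mult)
    finally have "sqrt (\<Sum>j<s. (ord_abs n e (Suc j))\<^sup>2) \<le> C * sqrt (\<Sum>j<s. (lam (Suc j))\<^sup>2)" .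
    then have "sqrt (\<Sum>j<s. (ord_abs n e (Suc j))\<^sup>2) * l2 n v \<le> C * sqrt (\<Sum>j<s. (lam (Suc j))\<^sup>2) * l2 n v"
      by (rule mult_right_mono) (rule l2_nonneg)
    then show "(\<Sum>j<s. ord_abs n e (Suc j) * ord_abs n v (Suc j)) \<le> C * sqrt (\<Sum>j<s. (lam (Suc j))\<^sup>2) * l2 n v"
      using sum_ord_abs_le_l2[OF s(2)] by (rule order_trans[rotated])
  next
    fix j assume "j \<in> {s..<n}"
    then have j: "s \<le> Suc j" "Suc j \<le> n" "j < n" by auto
    \<comment> \<open>The last of the top \<open>Suc j\<close> squares is at most their
      average.\<close>
    have "Suc j * (ord_abs n e (Suc j))\<^sup>2 = (\<Sum>i<Suc j. (ord_abs n e (Suc j))\<^sup>2)" by simp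
    also have "\<dots> \<le> (\<Sum>i<Suc j. (ord_abs n e (Suc i))\<^sup>2)"
      using j by (intro sum_mono power_mono ord_abs_antimono ord_abs_nonneg) auto
    also have "\<dots> \<le> Suc j * (C * lam (Suc j))\<^sup>2" using top[OF j(1,2)] .
    finally have "(ord_abs n e (Suc j))\<^sup>2 \<le> (C * lam (Suc j))\<^sup>2"
      by (simp del: of_nat_Suc)
    then have "ord_abs n e (Suc j) \<le> C * lam (Suc j)"
      by (rule power2_le_imp_le) (use C nonneg j in simp)
    then show "ord_abs n e (Suc j) * ord_abs n v (Suc j) \<le> C * lam (Suc j) * ord_abs n v (Suc j)"
      using j by (intro mult_right_mono ord_abs_nonneg)
  qed
  also have "\<dots> = C * (sqrt (\<Sum>j<s. (lam (Suc j))\<^sup>2) * l2 n v + (\<Sum>j=s..<n. lam (Suc j) * ord_abs n v (Suc j)))"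
    by (simp add: distrib_left sum_distrib_left mult.assoc)
  finally show ?thesis .
qed

text \<open>Comparing the minimiser with points of the segment towards the true parameter gains a factor
  two over comparing it with the true parameter itself.\<close>

lemma minimizer_basic_inequality:
  fixes X :: "nat \<Rightarrow> nat \<Rightarrow> real" and \<beta>s \<mu>s \<beta>h \<mu>h e :: "nat \<Rightarrow> real" and p :: nat
  assumes lam: "\<And>i j. i \<le> j \<Longrightarrow> j < n \<Longrightarrow> lam (Suc j) \<le> lam (Suc i)"
    and nonneg: "\<And>j. j < n \<Longrightarrow> 0 \<le> lam (Suc j)" and \<nu>: "0 \<le> \<nu>" and \<rho>: "0 \<le> \<rho>"
  defines "obj \<equiv> \<lambda>\<beta> \<mu>. sqnorm n (\<lambda>i. matvec n p X \<beta>s i + \<mu>s i + e i - matvec n p X \<beta> i - \<mu> i)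
      + 2 * \<nu> * l1 p \<beta> + 2 * \<rho> * sorted_l1 n lam \<mu>"
  defines "d \<equiv> \<lambda>i. matvec n p X (\<lambda>j. \<beta>h j - \<beta>s j) i + (\<mu>h i - \<mu>s i)"
  assumes min: "\<And>\<beta> \<mu>. obj \<beta>h \<mu>h \<le> obj \<beta> \<mu>"
  shows "sqnorm n d \<le> inner_n n e d + \<nu> * (l1 p \<beta>s - l1 p \<beta>h) + \<rho> * (sorted_l1 n lam \<mu>s - sorted_l1 n lam \<mu>h)"
proof -
  define R where "R = \<nu> * (l1 p \<beta>s - l1 p \<beta>h) + \<rho> * (sorted_l1 n lam \<mu>s - sorted_l1 n lam \<mu>h)"
  define G where "G = sqnorm n d - inner_n n e d - R"
  \<comment> \<open>At the point a fraction \<open>t\<close> towards the true parameter the residual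
    is \<open>e - (1 - t) * d\<close>. Terms of first order in \<open>t\<close> form
    \<open>G\<close>; the rest is quadratic in \<open>t\<close> and disappears as \<open>t\<close>
    tends to 0.\<close>
  have key: "G \<le> t * (sqnorm n d / 2)" if t: "0 < t" "t \<le> 1" for t
  proof -
    define \<beta> where "\<beta> = (\<lambda>j. (1 - t) * \<beta>h j + t * \<beta>s j)"
    define \<mu> where "\<mu> = (\<lambda>i. (1 - t) * \<mu>h i + t * \<mu>s i)"
    have mat: "matvec n p X \<beta> i = (1 - t) * matvec n p X \<beta>h i + t * matvec n p X \<beta>s i" for i
      unfolding matvec_def \<beta>_def sum_distrib_left sum.distrib[symmetric]
      by (intro sum.cong) (auto simp: algebra_simps)
    have d: "d i = matvec n p X \<beta>h i - matvec n p X \<beta>s i + (\<mu>h i - \<mu>s i)" for i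
      unfolding d_def matvec_def by (simp add: right_diff_distrib sum_subtractf)
    have sq: "sqnorm n (\<lambda>i. e i - c * d i) = sqnorm n e - 2 * c * inner_n n e d + c\<^sup>2 * sqnorm n d" for c
    proof -
      have "sqnorm n (\<lambda>i. e i - c * d i) = (\<Sum>i<n. (e i)\<^sup>2 - 2 * c * (e i * d i) + c\<^sup>2 * (d i)\<^sup>2)"
        unfolding sqnorm_def by (intro sum.cong) (auto simp: power2_eq_square algebra_simps)
      then show ?thesis
        by (simp add: sqnorm_def inner_n_def sum.distrib sum_subtractf sum_distrib_left)
    qed
    have "l1 p \<beta> \<le> (1 - t) * l1 p \<beta>h + t * l1 p \<beta>s"
      unfolding l1_def \<beta>_def sum_distrib_left sum.distrib[symmetric]
    proof (rule sum_mono)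
      fix j
      show "\<bar>(1 - t) * \<beta>h j + t * \<beta>s j\<bar> \<le> (1 - t) * \<bar>\<beta>h j\<bar> + t * \<bar>\<beta>s j\<bar>"
        using abs_triangle_ineq[of "(1 - t) * \<beta>h j" "t * \<beta>s j"] t by (simp add: abs_mult)
    qed
    then have b: "\<nu> * l1 p \<beta> \<le> \<nu> * ((1 - t) * l1 p \<beta>h + t * l1 p \<beta>s)"
      using \<nu> by (rule mult_left_mono)
    have "sorted_l1 n lam \<mu> \<le> (1 - t) * sorted_l1 n lam \<mu>h + t * sorted_l1 n lam \<mu>s"
      unfolding \<mu>_def using t by (intro sorted_l1_convex lam nonneg) auto
    then have m: "\<rho> * sorted_l1 n lam \<mu> \<le> \<rho> * ((1 - t) * sorted_l1 n lam \<mu>h + t * sorted_l1 n lam \<mu>s)"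
      using \<rho> by (rule mult_left_mono)
    have "(\<lambda>i. matvec n p X \<beta>s i + \<mu>s i + e i - matvec n p X \<beta>h i - \<mu>h i) = (\<lambda>i. e i - 1 * d i)"
      by (auto simp: d)
    moreover have "(\<lambda>i. matvec n p X \<beta>s i + \<mu>s i + e i - matvec n p X \<beta> i - \<mu> i) = (\<lambda>i. e i - (1 - t) * d i)"
      by (auto simp: d mat \<mu>_def algebra_simps)
    ultimately have "sqnorm n (\<lambda>i. e i - 1 * d i) + 2 * \<nu> * l1 p \<beta>h + 2 * \<rho> * sorted_l1 n lam \<mu>h
        \<le> sqnorm n (\<lambda>i. e i - (1 - t) * d i) + 2 * \<nu> * l1 p \<beta> + 2 * \<rho> * sorted_l1 n lam \<mu>"
      using min[of \<beta> \<mu>] unfolding obj_def by simp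
    then have "0 \<le> 2 * t * (t * (sqnorm n d / 2) - G)"
      using b m unfolding sq G_def R_def by (simp add: algebra_simps power2_eq_square)
    then show ?thesis using t by (simp add: zero_le_mult_iff)
  qed
  have "G \<le> 0"
  proof (rule field_le_epsilon)
    fix \<delta> :: real assume \<delta>: "0 < \<delta>"
    \<comment> \<open>The summand 1 keeps the denominator positive when \<open>d\<close>
      vanishes.\<close>
    define t where "t = min 1 (\<delta> / (sqnorm n d + 1))"
    have N: "0 \<le> sqnorm n d" by (rule sqnorm_nonneg)
    have t: "0 < t" "t \<le> 1" "t \<le> \<delta> / (sqnorm n d + 1)" using \<delta> N by (auto simp: t_def)
    have "t * (sqnorm n d / 2) \<le> t * (sqnorm n d + 1)"
      using t N by (intro mult_left_mono) auto
    also have "\<dots> \<le> \<delta>" using t(3) N by (simp add: field_simps)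
    finally show "G \<le> 0 + \<delta>" using key[OF t(1,2)] by simp
  qed
  then show ?thesis by (simp add: G_def R_def)
qed

text \<open>\<open>H\<close> is the mass of \<open>h\<close> on the support of \<open>u\<close>; off
  the support, \<open>u + h\<close> equals \<open>h\<close>. Both bounds on \<open>H\<close> are
  exported: \<open>sqrt k\<close> enters the cone and the rate, while \<open>H \<le> l1 p h\<close>
  improves the constant of the rate.\<close>

lemma l1_diff_le:
  fixes u h :: "nat \<Rightarrow> real"
  assumes "l0 p u \<le> k"
  obtains H where "l1 p u - l1 p (\<lambda>j. u j + h j) \<le> 2 * H - l1 p h" "H \<le> l1 p h" "H \<le> sqrt k * l2 p h"
proof
  let ?S = "{i. i < p \<and> u i \<noteq> 0}"
  define H where "H = (\<Sum>j\<in>?S. \<bar>h j\<bar>)"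
  have split: "(\<Sum>j<p. f j) = (\<Sum>j\<in>?S. f j) + (\<Sum>j\<in>{..<p} - ?S. f j)" for f :: "nat \<Rightarrow> real"
    using sum.subset_diff[of ?S "{..<p}" f] by (auto simp: add.commute)
  show "H \<le> l1 p h"
    unfolding H_def l1_def by (intro sum_mono2) auto
  have "(\<Sum>j\<in>?S. \<bar>u j\<bar>) - H \<le> (\<Sum>j\<in>?S. \<bar>u j + h j\<bar>)"
    unfolding H_def sum_subtractf[symmetric] by (intro sum_mono) auto
  moreover have "(\<Sum>j\<in>{..<p} - ?S. \<bar>u j\<bar>) = 0" by (intro sum.neutral) auto
  moreover have "(\<Sum>j\<in>{..<p} - ?S. \<bar>u j + h j\<bar>) = (\<Sum>j\<in>{..<p} - ?S. \<bar>h j\<bar>)"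
    by (intro sum.cong) auto
  ultimately show "l1 p u - l1 p (\<lambda>j. u j + h j) \<le> 2 * H - l1 p h"
    unfolding l1_def split by (simp add: H_def)
  have "H = (\<Sum>j\<in>?S. 1 * \<bar>h j\<bar>)" by (simp add: H_def)
  also have "\<dots> \<le> sqrt (\<Sum>j\<in>?S. 1\<^sup>2) * sqrt (\<Sum>j\<in>?S. \<bar>h j\<bar>\<^sup>2)"
    by (rule cauchy_schwarz_sqrt_sum)
  also have "\<dots> \<le> sqrt k * l2 p h"
    unfolding l2_def sqnorm_def using assms
    by (intro mult_mono real_sqrt_le_mono) (auto simp: l0_def intro!: sum_mono2 sum_nonneg)
  finally show "H \<le> sqrt k * l2 p h" .
qed

lemma inner_n_matvec_le:
  fixes e :: "nat \<Rightarrow> real" and X :: "nat \<Rightarrow> nat \<Rightarrow> real" and c :: real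
  assumes "\<And>j. j < p \<Longrightarrow> \<bar>\<Sum>i<n. X i j * e i\<bar> \<le> c"
  shows "inner_n n e (matvec n p X h) \<le> c * l1 p h"
proof -
  have "inner_n n e (matvec n p X h) = (\<Sum>i<n. \<Sum>j<p. X i j * e i * h j)"
    unfolding inner_n_def matvec_def by (simp add: sum_distrib_left mult_ac)
  also have "\<dots> = (\<Sum>j<p. (\<Sum>i<n. X i j * e i) * h j)"
    by (subst sum.swap) (simp add: sum_distrib_right)
  also have "\<dots> \<le> (\<Sum>j<p. c * \<bar>h j\<bar>)"
  proof (rule sum_mono)
    fix j assume "j \<in> {..<p}"
    then have "\<bar>\<Sum>i<n. X i j * e i\<bar> * \<bar>h j\<bar> \<le> c * \<bar>h j\<bar>"
      using assms by (intro mult_right_mono) auto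
    then show "(\<Sum>i<n. X i j * e i) * h j \<le> c * \<bar>h j\<bar>"
      using abs_ge_self[of "(\<Sum>i<n. X i j * e i) * h j"] by (simp add: abs_mult)
  qed
  finally show ?thesis by (simp add: l1_def sum_distrib_left)
qed

text \<open>Here \<open>l\<close> is the smallest weight \<open>\<lambda>\<^sub>n\<close>. The hypothesis on \<open>log p\<close> only gives
  \<open>\<nu> / \<rho> \<ge> 4 / 5 \<cdot> l\<close>, so both orders of \<open>\<nu> / \<rho>\<close> and \<open>l\<close> occur.\<close>

lemma cone_condition:
  fixes H J a b L l r \<nu> \<rho> w :: real
  assumes main: "\<nu> * H + \<rho> * J \<le> 4 * \<nu> * w * a + 4 * \<rho> * L * b"
    and L: "L \<le> l * r" and l: "0 < l" and \<rho>: "8 \<le> \<rho>" and \<nu>: "4 / 5 * l * \<rho> \<le> \<nu>"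
    and nonneg: "0 \<le> H" "0 \<le> J" "0 \<le> w" "0 \<le> a" "0 \<le> b" "0 \<le> r"
  shows "H + J / l \<le> 5 * (w * (\<nu> / l) * a + r * b)"
proof -
  have lr: "0 < l * \<rho>" using l \<rho> by simp
  have \<nu>0: "0 < \<nu>" using \<nu> lr by linarith
  have Lb: "L * b \<le> l * r * b" using L nonneg by (intro mult_right_mono)
  have wa: "0 \<le> w * a" and rb: "0 \<le> r * b" using nonneg by auto
  have main': "\<nu> * H + \<rho> * J \<le> 4 * \<nu> * (w * a) + 4 * (\<rho> * l) * (r * b)"
  proof -
    have "4 * \<rho> * (L * b) \<le> 4 * \<rho> * (l * r * b)" using Lb \<rho> by (intro mult_left_mono) auto
    moreover have "4 * \<rho> * L * b = 4 * \<rho> * (L * b)" "4 * (\<rho> * l) * (r * b) = 4 * \<rho> * (l * r * b)"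
      "4 * \<nu> * w * a = 4 * \<nu> * (w * a)" by simp_all
    ultimately show ?thesis using main by linarith
  qed
  have "l * H + J \<le> 5 * (\<nu> * (w * a) + l * (r * b))"
  proof (cases "l * \<rho> \<le> \<nu>")
    case True
    have "l * \<rho> * H \<le> \<nu> * H" using True nonneg by (intro mult_right_mono)
    then have "\<rho> * (l * H + J) \<le> 4 * \<nu> * (w * a) + 4 * (\<rho> * l) * (r * b)"
      using main' by (simp add: algebra_simps)
    also have "\<dots> \<le> \<rho> * (5 * (\<nu> * (w * a) + l * (r * b)))"
    proof -
      have "4 * (\<nu> * (w * a)) \<le> \<rho> * 5 * (\<nu> * (w * a))"
        using \<rho> \<nu>0 wa by (intro mult_right_mono) auto
      moreover have "0 \<le> \<rho> * (l * (r * b))" using \<rho> l rb by simp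
      ultimately show ?thesis by (simp add: algebra_simps)
    qed
    finally show ?thesis
      using \<rho> by simp
  next
    case False
    \<comment> \<open>Here one divides by \<open>\<nu>\<close> instead of \<open>\<rho>\<close>. The
      loss is at most \<open>l * \<rho> / \<nu> \<le> 5 / 4\<close>, which turns the factor 4 into
      the factor 5 of the cone.\<close>
    have "\<nu> * J \<le> l * \<rho> * J" using False nonneg by (intro mult_right_mono) auto
    then have "\<nu> * (l * H + J) \<le> l * (\<nu> * H + \<rho> * J)" by (simp add: algebra_simps)
    also have "\<dots> \<le> l * (4 * \<nu> * (w * a) + 4 * (\<rho> * l) * (r * b))"
      using main' l by (intro mult_left_mono) auto
    also have "\<dots> \<le> \<nu> * (5 * (\<nu> * (w * a) + l * (r * b)))"
    proof -
      have "l * 8 \<le> l * \<rho>" using l \<rho> by (intro mult_left_mono) auto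
      then have "4 * l \<le> 5 * \<nu>" using \<nu> l by linarith
      then have "4 * l * (\<nu> * (w * a)) \<le> 5 * \<nu> * (\<nu> * (w * a))"
        using \<nu>0 wa by (intro mult_right_mono) auto
      moreover have "4 * (\<rho> * l) = 5 * (4 / 5 * l * \<rho>)" by simp
      then have "4 * (\<rho> * l) \<le> 5 * \<nu>" using \<nu> by linarith
      then have "4 * (\<rho> * l) * (l * (r * b)) \<le> 5 * \<nu> * (l * (r * b))"
        using l rb by (intro mult_right_mono) auto
      ultimately show ?thesis by (simp add: algebra_simps)
    qed
    finally show ?thesis
      using \<nu>0 by simp
  qed
  then have "(l * H + J) / l \<le> 5 * (\<nu> * (w * a) + l * (r * b)) / l"
    using l by (intro divide_right_mono) auto
  then show ?thesis
    using l by (simp add: add_divide_distrib distrib_left mult_ac)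
qed

text \<open>Cauchy-Schwarz in the plane, through Lagrange's identity, followed by division by
  \<open>a\<^sup>2 + b\<^sup>2\<close>; hence the separate case where that sum is zero.\<close>

lemma square_bound_of_linear_bound:
  fixes c x y a b :: real
  assumes c: "0 < c" and le: "c * (a\<^sup>2 + b\<^sup>2) \<le> x * a + y * b"
  shows "a\<^sup>2 + b\<^sup>2 \<le> (x\<^sup>2 + y\<^sup>2) / c\<^sup>2"
proof (cases "a\<^sup>2 + b\<^sup>2 = 0")
  case True
  then show ?thesis using c by simp
next
  case False
  define N where "N = a\<^sup>2 + b\<^sup>2"
  have N: "0 < N" using False by (simp add: N_def sum_power2_gt_zero_iff)
  have "(c * N)\<^sup>2 \<le> (x * a + y * b)\<^sup>2"
    using le c N by (intro power_mono) (auto simp: N_def)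
  also have "\<dots> \<le> (x\<^sup>2 + y\<^sup>2) * N"
  proof -
    have "(x\<^sup>2 + y\<^sup>2) * N - (x * a + y * b)\<^sup>2 = (x * b - y * a)\<^sup>2"
      by (simp add: N_def power2_eq_square algebra_simps)
    then show ?thesis using zero_le_power2[of "x * b - y * a"] by linarith
  qed
  finally have "c\<^sup>2 * N * N \<le> (x\<^sup>2 + y\<^sup>2) * N"
    by (simp add: power_mult_distrib power2_eq_square mult_ac)
  then have "c\<^sup>2 * N \<le> x\<^sup>2 + y\<^sup>2" using N by simp
  then show ?thesis using c by (simp add: N_def field_simps)
qed

section \<open>The logarithmic weights and the final error bound\<close>

lemma log_weight_properties:
  fixes \<sigma> :: real and n :: nat
  assumes \<sigma>: "0 < \<sigma>"
  defines "lam \<equiv> \<lambda>i::nat. \<sigma> * sqrt (ln (2 * real n / real i))"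
  shows "\<And>i j. i \<le> j \<Longrightarrow> j < n \<Longrightarrow> lam (Suc j) \<le> lam (Suc i)"
    and "\<And>j. 0 < j \<Longrightarrow> j \<le> n \<Longrightarrow> 0 \<le> lam j"
    and "\<And>j. 0 < j \<Longrightarrow> j \<le> n \<Longrightarrow> (lam j)\<^sup>2 = \<sigma>\<^sup>2 * ln (2 * real n / real j)"
proof -
  show "lam (Suc j) \<le> lam (Suc i)" if "i \<le> j" "j < n" for i j
    unfolding lam_def using that \<sigma>
    by (intro mult_left_mono real_sqrt_le_mono) (auto simp: frac_le)
  have "0 \<le> ln (2 * real n / real j)" if "0 < j" "j \<le> n" for j
    using that by (intro ln_ge_zero) (simp add: field_simps)
  then show "0 \<le> lam j" "(lam j)\<^sup>2 = \<sigma>\<^sup>2 * ln (2 * real n / real j)" if "0 < j" "j \<le> n" for j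
    using that \<sigma> by (auto simp: lam_def power_mult_distrib)
qed

lemma sum_log_weight_power2_le:
  fixes \<sigma> :: real and n s :: nat
  assumes \<sigma>: "0 < \<sigma>" and s: "0 < s" "s \<le> n"
  defines "lam \<equiv> \<lambda>i::nat. \<sigma> * sqrt (ln (2 * real n / real i))"
  shows "(\<Sum>j=1..s. (lam j)\<^sup>2) \<le> \<sigma>\<^sup>2 * (real s * ln (2 * exp 1 * real n / real s))"
proof -
  have "(\<Sum>j=1..s. (lam j)\<^sup>2) = \<sigma>\<^sup>2 * (\<Sum>j=1..s. ln (2 * real n / real j))"
    unfolding sum_distrib_left lam_def using s by (intro sum.cong log_weight_properties(3)[OF \<sigma>]) auto
  also have "\<dots> \<le> \<sigma>\<^sup>2 * (real s * ln (2 * exp 1 * real n / real s))"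
    using s by (intro mult_left_mono sum_ln_ratio_le) auto
  finally show ?thesis .
qed

text \<open>The deterministic core: a fixed noise vector subject to the two noise bounds
  \<open>ev1\<close> and \<open>ev2\<close>. Because \<open>C \<le> \<rho> / 2\<close>, the noise
  consumes at most half of each penalty, and the remaining half controls the error.\<close>

lemma estimation_error_le:
  fixes n p k s :: nat and X :: "nat \<Rightarrow> nat \<Rightarrow> real"
    and \<beta>s \<mu>s \<beta>h \<mu>h \<epsilon> :: "nat \<Rightarrow> real" and \<sigma> \<rho> \<kappa>1 \<kappa>2 C :: real
  defines "lam \<equiv> \<lambda>i::nat. \<sigma> * sqrt (ln (2 * real n / real i))"
  defines "\<nu> \<equiv> 4 * \<sigma> * sqrt (ln (real p))"
  defines "\<kappa> \<equiv> sqrt (\<kappa>1 - 2 * \<kappa>2)"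
  assumes spos: "0 < s" and sn: "s \<le> n" and sbeta: "l0 p \<beta>s \<le> k" and smu: "l0 n \<mu>s \<le> s"
    and sig: "0 < \<sigma>" and \<rho>10: "10 \<le> \<rho>" and C0: "0 \<le> C" and C\<rho>: "C \<le> \<rho> / 2"
    and logp: "\<rho> * ln 2 / 4 \<le> sqrt (ln (real p))" and lnp: "1 \<le> ln (real p)"
    and kap: "2 * \<kappa>2 < \<kappa>1"
    and RE: "\<And>\<beta> \<mu>. l1 p \<beta> + sorted_l1 n lam \<mu> / (\<sigma> * sqrt (ln 2))
         \<le> 5 * (sqrt (16 * real k * ln (real p) / ln 2) * l2 p \<beta>
            + sqrt (real s * ln (2 * exp 1 * real n / real s) / ln 2) * l2 n \<mu>)
       \<Longrightarrow> sqnorm n (matvec n p X \<beta>) + sqnorm n \<mu> \<ge> \<kappa>1 * (sqnorm p \<beta> + sqnorm n \<mu>)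
         \<and> \<bar>inner_n n (matvec n p X \<beta>) \<mu>\<bar> \<le> \<kappa>2 * (sqnorm p \<beta> + sqnorm n \<mu>)"
    and ev1: "\<And>I. I \<subseteq> {..<n} \<Longrightarrow> s \<le> card I \<Longrightarrow>
      (\<Sum>i\<in>I. (\<epsilon> i)\<^sup>2) \<le> real (card I) * (C * lam (card I))\<^sup>2"
    and ev2: "\<And>j. j < p \<Longrightarrow> \<bar>\<Sum>i<n. X i j * \<epsilon> i\<bar> \<le> 2 * \<sigma> * sqrt (ln (real p))"
    and min: "\<And>\<beta> \<mu>. sqnorm n (\<lambda>i. matvec n p X \<beta>s i + \<mu>s i + \<epsilon> i - matvec n p X \<beta>h i - \<mu>h i)
          + 2 * \<nu> * l1 p \<beta>h + 2 * \<rho> * sorted_l1 n lam \<mu>h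
        \<le> sqnorm n (\<lambda>i. matvec n p X \<beta>s i + \<mu>s i + \<epsilon> i - matvec n p X \<beta> i - \<mu> i)
          + 2 * \<nu> * l1 p \<beta> + 2 * \<rho> * sorted_l1 n lam \<mu>"
  shows "sqnorm p (\<lambda>j. \<beta>h j - \<beta>s j) + sqnorm n (\<lambda>i. \<mu>h i - \<mu>s i)
      \<le> 36 / \<kappa>^4 * \<sigma>\<^sup>2 * real k * ln (real p) + 4 * \<rho>\<^sup>2 / \<kappa>^4 * (\<Sum>j=1..s. (lam j)\<^sup>2)"
proof -
  define L where "L = sqrt (\<Sum>j<s. (lam (Suc j))\<^sup>2)"
  have ln2: "2 / 3 \<le> ln (2::real)" by (rule ln2_ge_two_thirds)
  have lam_nonneg: "0 \<le> lam (Suc j)" if "j < n" for j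
    using log_weight_properties(2)[OF sig, of "Suc j" n] that by (simp add: lam_def)
  have lam_antimono: "lam (Suc j) \<le> lam (Suc i)" if "i \<le> j" "j < n" for i j
    using log_weight_properties(1)[OF sig that] by (simp add: lam_def)
  have Lle: "(\<Sum>j=1..s. (lam j)\<^sup>2) \<le> \<sigma>\<^sup>2 * (real s * ln (2 * exp 1 * real n / real s))"
    unfolding lam_def by (rule sum_log_weight_power2_le[OF sig spos sn])
  have L0: "0 \<le> L" unfolding L_def by (intro real_sqrt_ge_zero sum_nonneg) auto
  have Lsq: "L\<^sup>2 = (\<Sum>j=1..s. (lam j)\<^sup>2)"
    unfolding L_def by (simp add: sum_nonneg sum.atLeast1_atMost_eq)
  have \<kappa>2: "\<kappa>\<^sup>2 = \<kappa>1 - 2 * \<kappa>2" "0 < \<kappa>\<^sup>2" using kap by (auto simp: \<kappa>_def)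
  have \<kappa>4: "(\<kappa>\<^sup>2)\<^sup>2 = \<kappa> ^ 4" by simp
  define h where "h = (\<lambda>j. \<beta>h j - \<beta>s j)"
  define v where "v = (\<lambda>i. \<mu>h i - \<mu>s i)"
  define Q where "Q = sqnorm n (\<lambda>i. matvec n p X h i + v i)"
  define T where "T = (\<Sum>j=s..<n. lam (Suc j) * ord_abs n v (Suc j))"
  have \<nu>0: "0 \<le> \<nu>" using sig lnp by (simp add: \<nu>_def)
  have basic: "Q \<le> inner_n n \<epsilon> (\<lambda>i. matvec n p X h i + v i) + \<nu> * (l1 p \<beta>s - l1 p \<beta>h)
      + \<rho> * (sorted_l1 n lam \<mu>s - sorted_l1 n lam \<mu>h)"
    unfolding Q_def h_def v_def using \<rho>10 \<nu>0
    by (intro minimizer_basic_inequality lam_antimono lam_nonneg min) auto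
  have "inner_n n \<epsilon> (\<lambda>i. matvec n p X h i + v i) = inner_n n \<epsilon> (matvec n p X h) + inner_n n \<epsilon> v"
    by (simp add: inner_n_def distrib_left sum.distrib)
  moreover have "inner_n n \<epsilon> (matvec n p X h) \<le> \<nu> / 2 * l1 p h"
    using inner_n_matvec_le[where p = p and X = X and h = h, OF ev2] by (simp add: \<nu>_def)
  moreover have T0: "0 \<le> T"
    unfolding T_def by (intro sum_nonneg mult_nonneg_nonneg lam_nonneg ord_abs_nonneg) auto
  have "inner_n n \<epsilon> v \<le> C * (L * l2 n v + T)"
    unfolding L_def T_def
    by (intro inner_n_le_sorted lam_antimono lam_nonneg spos sn C0 ev1)
  moreover have "C * (L * l2 n v + T) \<le> \<rho> / 2 * (L * l2 n v + T)"
    using C\<rho> L0 l2_nonneg[of n v] T0 by (intro mult_right_mono) auto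
  moreover obtain HS where HS: "l1 p \<beta>s - l1 p (\<lambda>j. \<beta>s j + h j) \<le> 2 * HS - l1 p h"
      "HS \<le> l1 p h" "HS \<le> sqrt (real k) * l2 p h"
    using l1_diff_le[OF sbeta, of h] .
  have "\<nu> * (l1 p \<beta>s - l1 p \<beta>h) \<le> \<nu> * (2 * HS - l1 p h)"
    using HS(1) \<nu>0 by (intro mult_left_mono) (simp_all add: h_def)
  moreover have "sorted_l1 n lam \<mu>s - sorted_l1 n lam (\<lambda>i. \<mu>s i + v i) \<le> L * l2 n v - T"
    unfolding L_def T_def by (intro sorted_l1_diff_le lam_antimono lam_nonneg smu sn)
  then have "\<rho> * (sorted_l1 n lam \<mu>s - sorted_l1 n lam \<mu>h) \<le> \<rho> * (L * l2 n v - T)"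
    using \<rho>10 by (intro mult_left_mono) (simp_all add: v_def)
  \<comment> \<open>The penalties contribute \<open>2 * HS - l1 p h\<close> and
    \<open>L * l2 n v - T\<close>. The noise adds half of \<open>l1 p h\<close> and half of
    \<open>L * l2 n v + T\<close>.\<close>
  ultimately have Q: "Q \<le> \<nu> * (2 * HS - l1 p h / 2) + \<rho> * (3 / 2 * (L * l2 n v) - T / 2)"
    using basic by (simp add: algebra_simps)
  have Q0: "0 \<le> Q" unfolding Q_def by (rule sqnorm_nonneg)
  have \<nu>HS: "\<nu> * HS \<le> \<nu> * (sqrt (real k) * l2 p h)" "\<nu> * HS \<le> \<nu> * l1 p h"
    using HS \<nu>0 by (auto intro: mult_left_mono)
  have J: "sorted_l1 n lam v \<le> L * l2 n v + T"
  proof -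
    have "sorted_l1 n lam v = (\<Sum>j<s. lam (Suc j) * ord_abs n v (Suc j)) + T"
      by (simp add: sorted_l1_altdef T_def sum_lessThan_split[OF sn])
    then show ?thesis using sum_ord_abs_le_l2[OF sn, of "\<lambda>j. lam (Suc j)" v] by (simp add: L_def)
  qed
  define l where "l = \<sigma> * sqrt (ln 2)"
  define r where "r = sqrt (real s * ln (2 * exp 1 * real n / real s) / ln 2)"
  have l0: "0 < l" using sig by (simp add: l_def)
  have "1 \<le> 2 * exp 1 * real n / real s"
  proof -
    have "1 + 1 \<le> exp (1::real)" by (rule exp_ge_add_one_self)
    then have "1 * real s \<le> (2 * exp 1) * real n" using sn by (intro mult_mono) auto
    then show ?thesis using spos by simp
  qed
  then have lns: "0 \<le> ln (2 * exp 1 * real n / real s)" by simp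
  have "l1 p h + sorted_l1 n lam v / l \<le> 5 * (sqrt (real k) * (\<nu> / l) * l2 p h + r * l2 n v)"
  proof (rule cone_condition)
    \<comment> \<open>As \<open>Q\<close> is nonnegative, doubling its bound gives the factor 4 for
      \<open>HS\<close> and the factor 3 for \<open>L * l2 n v\<close>; the first \<open>s\<close>
      terms of the sorted norm raise 3 to 4.\<close>
    have "\<rho> * sorted_l1 n lam v \<le> \<rho> * (L * l2 n v + T)"
      using J \<rho>10 by (intro mult_left_mono) auto
    then show "\<nu> * l1 p h + \<rho> * sorted_l1 n lam v \<le> 4 * \<nu> * sqrt (real k) * l2 p h + 4 * \<rho> * L * l2 n v"
      using Q Q0 \<nu>HS by (simp add: algebra_simps)
    have "L\<^sup>2 \<le> (l * r)\<^sup>2"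
      using Lle lns unfolding Lsq by (simp add: l_def r_def power_mult_distrib)
    then show "L \<le> l * r" by (rule power2_le_imp_le) (use l0 lns in \<open>simp add: r_def\<close>)
    \<comment> \<open>The hypothesis \<open>logp\<close> says that \<open>\<nu>\<close> is at least
      \<open>\<sigma> * \<rho> * ln 2\<close>, which is
      \<open>sqrt (ln 2) * l * \<rho>\<close>.\<close>
    have "sqrt (16/25) \<le> sqrt (ln (2::real))" using ln2 by (intro real_sqrt_le_mono) simp
    then have q: "4 / 5 \<le> sqrt (ln (2::real))" by (simp add: real_sqrt_divide)
    have "4 / 5 * l * \<rho> \<le> sqrt (ln 2) * l * \<rho>"
      using q l0 \<rho>10 by (intro mult_right_mono) auto
    also have "\<dots> = \<sigma> * (\<rho> * ln 2)" by (simp add: l_def)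
    also have "\<dots> \<le> \<sigma> * (4 * sqrt (ln (real p)))" using logp sig by (intro mult_left_mono) auto
    finally show "4 / 5 * l * \<rho> \<le> \<nu>" by (simp add: \<nu>_def mult_ac)
    show "0 \<le> l1 p h" by (simp add: l1_def sum_nonneg)
    show "0 \<le> sorted_l1 n lam v"
      unfolding sorted_l1_altdef by (intro sum_nonneg mult_nonneg_nonneg lam_nonneg ord_abs_nonneg) auto
  qed (use l0 \<rho>10 lns in \<open>auto simp: r_def l2_nonneg\<close>)
  moreover have "sqrt (real k) * (\<nu> / l) = sqrt (16 * real k * ln (real p) / ln 2)"
    using sig by (simp add: \<nu>_def l_def real_sqrt_mult real_sqrt_divide)
  ultimately have "l1 p h + sorted_l1 n lam v / (\<sigma> * sqrt (ln 2))
      \<le> 5 * (sqrt (16 * real k * ln (real p) / ln 2) * l2 p h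
        + sqrt (real s * ln (2 * exp 1 * real n / real s) / ln 2) * l2 n v)"
    by (simp only: r_def l_def)
  note re = RE[OF this]
  have "Q = sqnorm n (matvec n p X h) + sqnorm n v + 2 * inner_n n (matvec n p X h) v"
    by (simp add: Q_def sqnorm_def inner_n_def power2_sum sum.distrib sum_distrib_left mult.assoc)
  \<comment> \<open>The cross term of the expanded square costs at most twice the incoherence bound
    \<open>\<kappa>2\<close>.\<close>
  then have "(\<kappa>1 - 2 * \<kappa>2) * (sqnorm p h + sqnorm n v) \<le> Q"
    using re by (simp add: left_diff_distrib abs_le_iff mult.assoc)
  \<comment> \<open>Here \<open>HS \<le> l1 p h\<close> reduces \<open>2 * HS\<close> to
    \<open>3 / 2 * HS\<close>, and \<open>3 / 2 * \<nu>\<close> yields the 6. The coefficient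
    \<open>3 / 2\<close> of \<open>\<rho>\<close> is rounded up to 2. Their squares are the 36 and 4
    of the conclusion.\<close>
  moreover have "Q \<le> 6 * \<sigma> * sqrt (real k * ln (real p)) * l2 p h + 2 * \<rho> * L * l2 n v"
  proof -
    have "0 \<le> \<rho> * T" "0 \<le> \<rho> * (L * l2 n v)" using \<rho>10 T0 L0 l2_nonneg[of n v] by auto
    then have "Q \<le> 3 / 2 * (\<nu> * (sqrt (real k) * l2 p h)) + 2 * (\<rho> * (L * l2 n v))"
      using Q \<nu>HS by (simp add: algebra_simps)
    then show ?thesis by (simp add: \<nu>_def real_sqrt_mult mult_ac)
  qed
  ultimately have "(l2 p h)\<^sup>2 + (l2 n v)\<^sup>2 \<le> ((6 * \<sigma> * sqrt (real k * ln (real p)))\<^sup>2 + (2 * \<rho> * L)\<^sup>2) / (\<kappa>\<^sup>2)\<^sup>2"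
    using \<kappa>2 by (intro square_bound_of_linear_bound) (auto simp: l2_power2)
  also have "\<dots> = 36 / \<kappa>^4 * \<sigma>\<^sup>2 * real k * ln (real p) + 4 * \<rho>\<^sup>2 / \<kappa>^4 * (\<Sum>j=1..s. (lam j)\<^sup>2)"
    unfolding \<kappa>4 using lnp by (simp add: power_mult_distrib Lsq add_divide_distrib)
  finally show ?thesis by (simp add: l2_power2 h_def v_def)
qed

text \<open>The bound is asserted on one measurable event for every minimiser simultaneously, so it
  covers any choice of minimiser, measurable in the noise or not. The event \<open>E\<close> avoids
  both bad sets, and on it the deterministic estimate applies with
  \<open>C = 4 + sqrt 2\<close>.\<close>

theorem theorem3:
  fixes n p k s :: nat and X :: "nat \<Rightarrow> nat \<Rightarrow> real"
    and \<beta>s \<mu>s :: "nat \<Rightarrow> real"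
    and \<sigma> \<rho> \<kappa>1 \<kappa>2 :: real
  assumes cols: "\<forall>j<p. (\<Sum>i<n. (X i j)\<^sup>2) = 1"
    and kpos: "k > 0" and spos: "s > 0" and sn: "s \<le> n"
    and sbeta: "l0 p \<beta>s \<le> k" and smu: "l0 n \<mu>s \<le> s"
    and sig: "\<sigma> > 0"
    and rho: "\<rho> \<ge> 2 * (4 + sqrt 2)"
    and logp: "sqrt (ln p) \<ge> \<rho> * ln 2 / 4"
    and kap: "\<kappa>1 > 2 * \<kappa>2" "\<kappa>2 > 0"
    and RE: "\<And>\<beta> \<mu>.
       l1 p \<beta> + (\<Sum>j=1..n. (\<sigma> * sqrt (ln (2 * n / j))) / (\<sigma> * sqrt (ln (2 * n / n))) * ord_abs n \<mu> j)
         \<le> 5 * (sqrt (16 * k * ln p / ln 2) * l2 p \<beta> + sqrt (s * ln (2 * exp 1 * n / s) / ln 2) * l2 n \<mu>)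
       \<Longrightarrow> sqnorm n (matvec n p X \<beta>) + sqnorm n \<mu> \<ge> \<kappa>1 * (sqnorm p \<beta> + sqnorm n \<mu>)
         \<and> \<bar>inner_n n (matvec n p X \<beta>) \<mu>\<bar> \<le> \<kappa>2 * (sqnorm p \<beta> + sqnorm n \<mu>)"
  shows "\<exists>E \<in> sets (gauss_vec n \<sigma>).
    measure (gauss_vec n \<sigma>) E \<ge> 1 - (1/2) * (s / (2 * n)) ^ s - 1 / p \<and>
    (\<forall>\<epsilon> \<in> E. \<forall>\<beta>h \<mu>h.
      (let lam = (\<lambda>i. \<sigma> * sqrt (ln (2 * n / i)));
           \<nu> = 4 * \<sigma> * sqrt (ln p);
           y = (\<lambda>i. matvec n p X \<beta>s i + \<mu>s i + \<epsilon> i);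
           obj = (\<lambda>\<beta> \<mu>. sqnorm n (\<lambda>i. y i - matvec n p X \<beta> i - \<mu> i)
                        + 2 * \<nu> * l1 p \<beta> + 2 * \<rho> * sorted_l1 n lam \<mu>);
           \<kappa> = sqrt (\<kappa>1 - 2 * \<kappa>2)
       in (\<forall>\<beta> \<mu>. obj \<beta>h \<mu>h \<le> obj \<beta> \<mu>) \<longrightarrow>
          sqnorm p (\<lambda>j. \<beta>h j - \<beta>s j) + sqnorm n (\<lambda>i. \<mu>h i - \<mu>s i)
            \<le> 36 / \<kappa>^4 * \<sigma>\<^sup>2 * k * ln p + 4 * \<rho>\<^sup>2 / \<kappa>^4 * (\<Sum>j=1..s. (lam j)\<^sup>2)
          \<and> 36 / \<kappa>^4 * \<sigma>\<^sup>2 * k * ln p + 4 * \<rho>\<^sup>2 / \<kappa>^4 * (\<Sum>j=1..s. (lam j)\<^sup>2)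
            \<le> 4 * \<sigma>\<^sup>2 / \<kappa>^4 * (9 * k * ln p + \<rho>\<^sup>2 * s * ln (2 * exp 1 * n / s))))"
proof -
  define M where "M = gauss_vec n \<sigma>"
  define lam where "lam i = \<sigma> * sqrt (ln (2 * real n / real i))" for i :: nat
  define \<nu> where "\<nu> = 4 * \<sigma> * sqrt (ln (real p))"
  define \<kappa> where "\<kappa> = sqrt (\<kappa>1 - 2 * \<kappa>2)"
  define B1 where "B1 = (\<Union>I\<in>{I. I \<subseteq> {..<n} \<and> s \<le> card I}. {\<epsilon> \<in> space M.
    (4 + sqrt 2)\<^sup>2 * (real (card I) * ln (2 * real n / real (card I))) * \<sigma>\<^sup>2 < (\<Sum>i\<in>I. (\<epsilon> i)\<^sup>2)})"
  define B2 where "B2 = (\<Union>j<p. {\<epsilon> \<in> space M. 2 * \<sigma> * sqrt (ln (real p)) < \<bar>\<Sum>i<n. X i j * \<epsilon> i\<bar>})"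
  interpret prob_space M unfolding M_def by (rule prob_space_gauss_vec[OF sig])
  have n: "0 < n" using spos sn by simp
  have "2 * (4 + 1) \<le> 2 * (4 + sqrt 2)" by (intro mult_left_mono add_left_mono) auto
  then have "2 * (4 + 1) \<le> \<rho>" using rho by (rule order_trans)
  then have \<rho>10: "10 \<le> \<rho>" by simp
  \<comment> \<open>The left side is \<open>5 / 3\<close>, so \<open>ln p\<close> is at least 1, as
    the bound for the columns requires.\<close>
  have "10 * (2 / 3) / 4 \<le> \<rho> * ln 2 / 4"
    using \<rho>10 ln2_ge_two_thirds by (intro divide_right_mono mult_mono) auto
  then have "10 * (2 / 3) / 4 \<le> sqrt (ln (real p))" using logp by (rule order_trans)
  then have "1 \<le> sqrt (ln (real p))" by (rule order_trans[rotated]) simp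
  then have lnp: "1 \<le> ln (real p)" by simp
  have B1: "prob B1 \<le> 1 / 2 * (real s / (2 * real n)) ^ s" "B1 \<in> events"
    using gauss_vec_sum_squares_event[OF sig spos sn] by (simp_all add: B1_def M_def)
  have B2: "prob B2 \<le> 1 / real p" "B2 \<in> events"
    using gauss_vec_columns_event[OF sig cols lnp] by (simp_all add: B2_def M_def)
  define E where "E = space M - (B1 \<union> B2)"
  have E: "E \<in> events" using B1(2) B2(2) by (auto simp: E_def)
  have "prob E = 1 - prob (B1 \<union> B2)"
    unfolding E_def using B1 B2 by (intro prob_compl) auto
  moreover have "prob (B1 \<union> B2) \<le> prob B1 + prob B2"
    using B1 B2 by (intro measure_Un_le)
  ultimately have pr: "prob E \<ge> 1 - (1 / 2) * (real s / (2 * real n)) ^ s - 1 / real p"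
    using B1 B2 by simp
  have second: "36 / \<kappa>^4 * \<sigma>\<^sup>2 * real k * ln (real p) + 4 * \<rho>\<^sup>2 / \<kappa>^4 * (\<Sum>j=1..s. (lam j)\<^sup>2)
      \<le> 4 * \<sigma>\<^sup>2 / \<kappa>^4 * (9 * real k * ln (real p) + \<rho>\<^sup>2 * real s * ln (2 * exp 1 * real n / real s))"
  proof -
    have "(\<Sum>j=1..s. (lam j)\<^sup>2) \<le> \<sigma>\<^sup>2 * (real s * ln (2 * exp 1 * real n / real s))"
      unfolding lam_def by (rule sum_log_weight_power2_le[OF sig spos sn])
    then have "4 * \<rho>\<^sup>2 / \<kappa>^4 * (\<Sum>j=1..s. (lam j)\<^sup>2)
        \<le> 4 * \<rho>\<^sup>2 / \<kappa>^4 * (\<sigma>\<^sup>2 * (real s * ln (2 * exp 1 * real n / real s)))"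
      by (rule mult_left_mono) simp
    then show ?thesis by (simp add: distrib_left mult_ac)
  qed
  have first: "sqnorm p (\<lambda>j. \<beta>h j - \<beta>s j) + sqnorm n (\<lambda>i. \<mu>h i - \<mu>s i)
      \<le> 36 / \<kappa>^4 * \<sigma>\<^sup>2 * real k * ln (real p) + 4 * \<rho>\<^sup>2 / \<kappa>^4 * (\<Sum>j=1..s. (lam j)\<^sup>2)"
    if \<epsilon>: "\<epsilon> \<in> E"
      and min: "\<forall>\<beta> \<mu>. sqnorm n (\<lambda>i. matvec n p X \<beta>s i + \<mu>s i + \<epsilon> i - matvec n p X \<beta>h i - \<mu>h i)
          + 2 * \<nu> * l1 p \<beta>h + 2 * \<rho> * sorted_l1 n lam \<mu>h
        \<le> sqnorm n (\<lambda>i. matvec n p X \<beta>s i + \<mu>s i + \<epsilon> i - matvec n p X \<beta> i - \<mu> i)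
          + 2 * \<nu> * l1 p \<beta> + 2 * \<rho> * sorted_l1 n lam \<mu>" for \<epsilon> \<beta>h \<mu>h :: "nat \<Rightarrow> real"
    unfolding \<kappa>_def lam_def
  proof (rule estimation_error_le[OF spos sn sbeta smu sig \<rho>10 _ _ logp lnp kap(1), where C = "4 + sqrt 2" and \<epsilon> = \<epsilon>])
    show "4 + sqrt 2 \<le> \<rho> / 2" using rho by simp
    show "(\<Sum>i\<in>I. (\<epsilon> i)\<^sup>2) \<le> real (card I) * ((4 + sqrt 2) * (\<sigma> * sqrt (ln (2 * real n / real (card I)))))\<^sup>2"
      if I: "I \<subseteq> {..<n}" "s \<le> card I" for I
    proof -
      have "card I \<le> card {..<n}" using I(1) by (intro card_mono) auto
      then have c: "0 < card I" "card I \<le> n" using I(2) spos by auto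
      have "(\<Sum>i\<in>I. (\<epsilon> i)\<^sup>2) \<le> (4 + sqrt 2)\<^sup>2 * (real (card I) * ln (2 * real n / real (card I))) * \<sigma>\<^sup>2"
        using \<epsilon> I unfolding E_def B1_def by (auto simp: not_less)
      also have "\<dots> = real (card I) * ((4 + sqrt 2) * (\<sigma> * sqrt (ln (2 * real n / real (card I)))))\<^sup>2"
        unfolding power_mult_distrib[of "4 + sqrt 2"] log_weight_properties(3)[OF sig c] by (simp only: mult_ac)
      finally show ?thesis .
    qed
    show "\<bar>\<Sum>i<n. X i j * \<epsilon> i\<bar> \<le> 2 * \<sigma> * sqrt (ln (real p))" if "j < p" for j
      using \<epsilon> that unfolding E_def B2_def by (auto simp: not_less)
  next
    fix \<beta> \<mu> :: "nat \<Rightarrow> real"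
    assume cone: "l1 p \<beta> + sorted_l1 n (\<lambda>i. \<sigma> * sqrt (ln (2 * real n / real i))) \<mu> / (\<sigma> * sqrt (ln 2))
         \<le> 5 * (sqrt (16 * real k * ln (real p) / ln 2) * l2 p \<beta>
            + sqrt (real s * ln (2 * exp 1 * real n / real s) / ln 2) * l2 n \<mu>)"
    \<comment> \<open>Since \<open>n\<close> is positive, \<open>2 * n / n\<close> is 2 and the last
      weight is \<open>\<sigma> * sqrt (ln 2)\<close>.\<close>
    have "sorted_l1 n (\<lambda>i. \<sigma> * sqrt (ln (2 * real n / real i))) \<mu> / (\<sigma> * sqrt (ln 2))
      = (\<Sum>j=1..n. (\<sigma> * sqrt (ln (2 * real n / real j))) / (\<sigma> * sqrt (ln (2 * real n / real n))) * ord_abs n \<mu> j)"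
      using n sig by (simp add: sorted_l1_def sum_divide_distrib)
    with cone show "sqnorm n (matvec n p X \<beta>) + sqnorm n \<mu> \<ge> \<kappa>1 * (sqnorm p \<beta> + sqnorm n \<mu>)
         \<and> \<bar>inner_n n (matvec n p X \<beta>) \<mu>\<bar> \<le> \<kappa>2 * (sqnorm p \<beta> + sqnorm n \<mu>)"
      by (intro RE) simp
  qed (use min in \<open>simp_all add: \<nu>_def lam_def[abs_def]\<close>)
  show ?thesis
    unfolding Let_def of_nat_mult of_nat_numeral lam_def[symmetric] \<nu>_def[symmetric] \<kappa>_def[symmetric] M_def[symmetric]
    by (intro bexI[OF _ E] conjI ballI allI impI pr first second) blast+
qed

end
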